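(* Let $m\ge0$ be an integer and let $\mu_0,\dots,\mu_m\in\Lambda+\sharp$ be different points. If the series $$\sum_{\lambda\in\Lambda}(|\lambda|^2+1)^m|c_\lambda|^2$$ converges and $$\sum_{j=0}^mb_j\mathbf{d}_{m,j}+\sum_{\lambda\in\Lambda}c_\lambda\mathbf{e}_\lambda=0$$ for some $b_0,\dots,b_m\in\mathbb{C}$, then $b_0=\dots=b_m=0$ and $c_\lambda=0$ for all $\lambda\in\Lambda$.
   Context: For $\lambda=(p,\theta)\in\mathbb{R}\times\mathbb{R}$, $|\lambda|^2=p^2+\theta^2$ and the Gabor function is $\mathbf{e}_\lambda(x)=2^{1/4}\exp(-\pi(x-p)^2+2\pi i\theta x)$, $x\in\mathbb{R}$. $\Lambda=\mathbb{Z}\times\mathbb{Z}$, $\sharp=(1/2,1/2)$; $c_\lambda\in\mathbb{C}$, and series $\sum c_\lambda\mathbf{e}_\lambda$ with $\{c_\lambda\}\in l_2(\Lambda)$ converge in $L_2(\mathbb{R})$. The annihilation operator is $\mathbf{a}=\frac{1}{2\pi}\frac{d}{dx}+x$. With $\Theta(z)=2^{1/4}\sum_{q\in\mathbb{Z}}\exp(2\pi iqz-\pi q^2)$, the sharp Poisson functional is $\gamma^\sharp(f)=\frac{1}{i\Theta(0)}\sum_{q\in\mathbb{Z}}(-1)^qf(q+1/2)$ (applied below only to Schwartz functions). The functions $\mathbf{d}_{m,j}$, $j=0,\dots,m$, are the linear combinations $\mathbf{d}_{m,j}=\sum_{s=0}^mh_j^s\mathbf{e}_{\mu_s}$ whose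 coefficients $h_j^s\in\mathbb{C}$ are determined by $\gamma^\sharp(\mathbf{a}^k\mathbf{d}_{m,j})=\delta_j^k$ (Kronecker delta) for $k,j=0,\dots,m$. *)

theory Defs
  imports "HOL-Analysis.Analysis"
begin

definition gabor :: "real \<times> real \<Rightarrow> real \<Rightarrow> complex" where
  "gabor l x = (case l of (p, \<theta>) \<Rightarrow>
     complex_of_real (2 powr (1/4)) *
       exp (- complex_of_real (pi * (x - p)\<^sup>2) + 2 * complex_of_real pi * \<i> * complex_of_real (\<theta> * x)))"

definition Lattice :: "(real \<times> real) set" where
  "Lattice = \<int> \<times> \<int>"

definition sharp :: "real \<times> real" where
  "sharp = (1/2, 1/2)"

definition sharp_Lattice :: "(real \<times> real) set" where
  "sharp_Lattice = (\<lambda>l. l + sharp) ` Lattice"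

definition annihilation :: "(real \<Rightarrow> complex) \<Rightarrow> real \<Rightarrow> complex" where
  "annihilation f x = vector_derivative f (at x) / complex_of_real (2 * pi) + complex_of_real x * f x"

definition Theta :: "complex \<Rightarrow> complex" where
  "Theta z = complex_of_real (2 powr (1/4)) *
     (\<Sum>\<^sub>\<infinity>q::int. exp (2 * complex_of_real pi * \<i> * of_int q * z - complex_of_real pi * (of_int q)\<^sup>2))"

text \<open>Meaningful only for functions of sufficient decay, e.g. Schwartz functions, where the sum
  converges absolutely; otherwise \<^const>\<open>infsum\<close> may return its default value 0.\<close>
definition sharp_Poisson :: "(real \<Rightarrow> complex) \<Rightarrow> complex" where
  "sharp_Poisson f =
     1 / (\<i> * Theta 0) * (\<Sum>\<^sub>\<infinity>q::int. (-1) powi q * f (of_int q + 1/2))"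

definition gabor_comb ::
    "nat \<Rightarrow> (nat \<Rightarrow> real \<times> real) \<Rightarrow> (nat \<Rightarrow> complex) \<Rightarrow> real \<Rightarrow> complex" where
  "gabor_comb m \<mu> a x = (\<Sum>s\<le>m. a s * gabor (\<mu> s) x)"

text \<open>\<open>h j s\<close> is the coefficient \<open>h\<^sub>j\<^sup>s\<close>. Since \<open>gabor (p, \<theta>)\<close> is an eigenfunction of
  \<^const>\<open>annihilation\<close> with eigenvalue \<open>p + \<i> \<theta>\<close>, for distinct points \<open>\<mu> s\<close> of
  \<^const>\<open>sharp_Lattice\<close> these equations form a nonsingular (Vandermonde type) linear system, so
  they determine \<open>h j s\<close> for \<open>j, s \<le> m\<close>.\<close>
definition dual_coeffs ::
    "nat \<Rightarrow> (nat \<Rightarrow> real \<times> real) \<Rightarrow> (nat \<Rightarrow> nat \<Rightarrow> complex) \<Rightarrow> bool" where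
  "dual_coeffs m \<mu> h \<longleftrightarrow>
     (\<forall>k\<le>m. \<forall>j\<le>m. sharp_Poisson ((annihilation ^^ k) (gabor_comb m \<mu> (h j)))
        = (if k = j then 1 else 0))"

definition L2_fun :: "(real \<Rightarrow> complex) \<Rightarrow> bool" where
  "L2_fun f \<longleftrightarrow> f \<in> borel_measurable lborel \<and> integrable lborel (\<lambda>x. (norm (f x))\<^sup>2)"

text \<open>Unconditional summability in \<open>L\<^sub>2(\<real>)\<close>, the analogue of \<^const>\<open>has_sum\<close> for the \<open>L\<^sub>2\<close> norm;
  the sum \<open>g\<close> is a representative, unique up to null sets.\<close>
definition has_L2_sum :: "('i \<Rightarrow> real \<Rightarrow> complex) \<Rightarrow> 'i set \<Rightarrow> (real \<Rightarrow> complex) \<Rightarrow> bool" where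
  "has_L2_sum f A g \<longleftrightarrow>
     (\<forall>i\<in>A. L2_fun (f i)) \<and> L2_fun g \<and>
     ((\<lambda>F. LINT x|lborel. (norm ((\<Sum>i\<in>F. f i x) - g x))\<^sup>2) \<longlongrightarrow> 0) (finite_subsets_at_top A)"

end

theory Submission
  imports Defs "HOL-Probability.Characteristic_Functions"
begin

text \<open>Pairing the relation with all Gabor functions \<open>e\<^sub>\<nu>\<close> gives, up to a nonvanishing
  factor, an entire function of the conjugate of \<open>\<nu>\<close> whose Taylor coefficients are the moments \<open>\<Sum> c\<^sub>z \<kappa>\<^sub>z z\<^sup>n\<close>, with
  \<open>\<kappa>\<close> of Gaussian decay, so the relation says that all moments vanish. In this form it may be
  multiplied by polynomials in \<open>z\<close>, which is how powers of the annihilation operator act.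

  The key point is that if \<open>c\<close> is in \<open>l\<^sub>2(\<Lambda>)\<close> then the sharp Poisson functional, although not
  continuous on \<open>L\<^sub>2\<close>, may be applied to the relation term by term. It kills \<open>e\<^sub>\<lambda>\<close>
  for \<open>\<lambda> \<in> \<Lambda>\<close>; applied after multiplication by \<open>z\<^sup>k\<close>, \<open>k \<le> m\<close>, it yields
  \<open>b\<^sub>k = 0\<close>.

  What remains is a relation on \<open>\<Lambda>\<close> alone. Dividing \<open>c\<close> by \<open>z - w\<close>, with \<open>w\<close> the sharp
  point, again gives a relation, now with one extra term at \<open>w\<close>, which the sharp functional shows
  to be 0. So all \<open>c / (z - w)\<^sup>k\<close> have vanishing moments, and letting \<open>k\<close> tend to infinity, after
  multiplication by a polynomial vanishing at the other points near \<open>w\<close>, isolates each single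
  coefficient.\<close>

section \<open>Sums over the lattice\<close>

text \<open>The point (p, \<theta>) as p + i \<theta>, the eigenvalue of \<open>annihilation\<close>
  on \<open>gabor (p, \<theta>)\<close>.\<close>

definition to_complex :: "real \<times> real \<Rightarrow> complex" where
  "to_complex l = Complex (fst l) (snd l)"

text \<open>A product of two Cauchy densities, up to normalisation. The product form lets lattice
  sums factor, the total mass stays bounded as R grows, and the square of R / (R^2 + |l|^2) lies
  below it.\<close>

definition lattice_weight :: "real \<Rightarrow> real \<times> real \<Rightarrow> real" where
  "lattice_weight R l = (R / (R\<^sup>2 + (fst l)\<^sup>2)) * (R / (R\<^sup>2 + (snd l)\<^sup>2))"

lemma norm_to_complex: "norm (to_complex l) = norm l"
  by (cases l) (simp add: to_complex_def norm_Pair cmod_def)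

lemma norm_power2_prod: "(norm (l :: real \<times> real))\<^sup>2 = (fst l)\<^sup>2 + (snd l)\<^sup>2"
  by (cases l) (simp add: norm_Pair)

lemma LatticeE:
  assumes "l \<in> Lattice"
  obtains a b where "l = (of_int a, of_int b)"
  using assms by (auto simp: Lattice_def elim!: Ints_cases)

lemma sharp_LatticeE:
  assumes "l \<in> sharp_Lattice"
  obtains a b where "l = (of_int a + 1/2, of_int b + 1/2)"
  using assms by (auto simp: sharp_Lattice_def sharp_def elim!: LatticeE)

lemma Lattice_sharp_disjoint: "Lattice \<inter> sharp_Lattice = {}"
proof -
  have "of_int a \<noteq> (of_int b + 1/2 :: real)" for a b :: int
  proof
    assume "of_int a = (of_int b + 1/2 :: real)"
    hence "of_int (2 * a) = (of_int (2 * b + 1) :: real)" by simp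
    hence "2 * a = 2 * b + 1" by (simp only: of_int_eq_iff)
    thus False by presburger
  qed
  thus ?thesis by (auto elim!: LatticeE sharp_LatticeE) metis
qed

text \<open>Telescoping: (R + n + 1)^2 \<le> 2 (R^2 + (n + 1)^2) bounds the new term by 2R / ((R +
  n)(R + n + 1)), a difference of consecutive values of 2R / (R + n). The first term is 1 / R, at
  most 1 = 3 - 2.\<close>

lemma sum_Cauchy_density_nat:
  fixes R :: real
  assumes "R \<ge> 1"
  shows "(\<Sum>k\<le>n. R / (R\<^sup>2 + (real k)\<^sup>2)) \<le> 3 - 2 * R / (R + real n)"
proof (induction n)
  case 0
  show ?case using assms by (simp add: power2_eq_square)
next
  case (Suc n)
  have pos: "R + real n > 0" "R\<^sup>2 + (real (Suc n))\<^sup>2 > 0"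
    using assms by (auto intro: add_pos_nonneg)
  have "(R + real n) * (R + real (Suc n)) \<le> (R + real (Suc n))\<^sup>2"
    using assms by (simp add: power2_eq_square mult_right_mono)
  also have "\<dots> \<le> 2 * (R\<^sup>2 + (real (Suc n))\<^sup>2)"
    using sum_squares_bound[of R "real (Suc n)"] by (simp add: power2_eq_square algebra_simps)
  finally have "R * ((R + real n) * (R + real (Suc n))) \<le> R * (2 * (R\<^sup>2 + (real (Suc n))\<^sup>2))"
    using assms by (intro mult_left_mono) auto
  hence "R / (R\<^sup>2 + (real (Suc n))\<^sup>2) \<le> 2 * R / ((R + real n) * (R + real (Suc n)))"
    using pos assms by (simp add: divide_le_eq le_divide_eq mult.commute mult.left_commute del: of_nat_Suc)
  also have "\<dots> = 2 * R / (R + real n) - 2 * R / (R + real (Suc n))"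
    using pos by (simp add: divide_simps) (simp add: algebra_simps)
  finally show ?case using Suc.IH by simp
qed

lemma sum_Cauchy_density_Ints:
  fixes R :: real
  assumes "R \<ge> 1" "finite A" "A \<subseteq> \<int>"
  shows "(\<Sum>x\<in>A. R / (R\<^sup>2 + x\<^sup>2)) \<le> 6"
proof -
  let ?f = "\<lambda>x::real. R / (R\<^sup>2 + x\<^sup>2)"
  define n where "n = nat \<lceil>Max (insert 0 (abs ` A))\<rceil>"
  have n: "\<bar>x\<bar> \<le> real n" if "x \<in> A" for x
  proof -
    have "\<bar>x\<bar> \<le> Max (insert 0 (abs ` A))" using that assms(2) by (intro Max_ge) auto
    also have "\<dots> \<le> real n" unfolding n_def by linarith
    finally show ?thesis .
  qed
  have "A \<subseteq> real ` {..n} \<union> (\<lambda>k. - real k) ` {..n}"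
  proof
    fix x assume x: "x \<in> A"
    then obtain z where z: "x = of_int z" using assms(3) by (auto elim: Ints_cases)
    have "nat \<bar>z\<bar> \<le> n" using n[OF x] z by linarith
    moreover have "x = real (nat \<bar>z\<bar>) \<or> x = - real (nat \<bar>z\<bar>)" using z by (cases "z \<ge> 0") auto
    ultimately show "x \<in> real ` {..n} \<union> (\<lambda>k. - real k) ` {..n}" by blast
  qed
  hence "sum ?f A \<le> sum ?f (real ` {..n} \<union> (\<lambda>k. - real k) ` {..n})"
    using assms by (intro sum_mono2) auto
  also have "\<dots> \<le> sum ?f (real ` {..n}) + sum ?f ((\<lambda>k. - real k) ` {..n})"
    using assms by (subst sum.union_inter[symmetric]) (auto intro!: sum_nonneg)
  also have "sum ?f (real ` {..n}) = (\<Sum>k\<le>n. ?f (real k))"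
    by (subst sum.reindex) (auto simp: inj_on_def)
  also have "sum ?f ((\<lambda>k. - real k) ` {..n}) = (\<Sum>k\<le>n. ?f (real k))"
    by (subst sum.reindex) (auto simp: inj_on_def)
  also have "(\<Sum>k\<le>n. ?f (real k)) + (\<Sum>k\<le>n. ?f (real k)) \<le> 6"
  proof -
    have "2 * R / (R + real n) \<ge> 0" using assms(1) by simp
    thus ?thesis using sum_Cauchy_density_nat[OF assms(1), of n] by linarith
  qed
  finally show ?thesis .
qed

lemma lattice_weight_nonneg: "R \<ge> 0 \<Longrightarrow> lattice_weight R l \<ge> 0"
  by (simp add: lattice_weight_def)

text \<open>A finite set lies in the product of its two projections, where the sum factors into two
  one-dimensional sums, each at most 6. What matters later is that the bound does not depend on
  R.\<close>

lemma sum_lattice_weight_le: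
  assumes "R \<ge> 1" "finite F" "F \<subseteq> Lattice"
  shows "(\<Sum>l\<in>F. lattice_weight R l) \<le> 36"
proof -
  let ?f = "\<lambda>x::real. R / (R\<^sup>2 + x\<^sup>2)"
  have "(\<Sum>l\<in>F. lattice_weight R l) \<le> (\<Sum>l\<in>fst ` F \<times> snd ` F. lattice_weight R l)"
    using assms by (intro sum_mono2) (auto simp: lattice_weight_nonneg rev_image_eqI)
  also have "\<dots> = sum ?f (fst ` F) * sum ?f (snd ` F)"
    by (simp add: lattice_weight_def sum_product sum.cartesian_product case_prod_unfold)
  also have "\<dots> \<le> 6 * 6"
    using assms by (intro mult_mono sum_Cauchy_density_Ints sum_nonneg) (auto simp: Lattice_def)
  finally show ?thesis by simp
qed

lemma lattice_weight_summable:
  assumes "R \<ge> 1"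
  shows "lattice_weight R summable_on Lattice"
  using assms sum_lattice_weight_le[OF assms]
  by (intro nonneg_bdd_above_summable_on) (auto simp: lattice_weight_nonneg intro!: bdd_aboveI[of _ 36])

lemma infsum_lattice_weight_le:
  assumes "R \<ge> 1"
  shows "infsum (lattice_weight R) Lattice \<le> 36"
  using sum_lattice_weight_le[OF assms] by (intro infsum_le_finite_sums lattice_weight_summable assms)

lemma lattice_weight_shift: "lattice_weight 1 (l + sharp) \<le> 9 * lattice_weight 1 l"
proof -
  have *: "1 / (1 + (x + 1/2)\<^sup>2) \<le> 3 * (1 / (1 + x\<^sup>2))" for x :: real
  proof -
    \<comment> \<open>Twice the difference of the two sides is (2x + 3/2)^2 + 13/4.\<close>
    have "1 + x\<^sup>2 \<le> 3 * (1 + (x + 1/2)\<^sup>2)"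
      using zero_le_power2[of "2 * x + 3/2"] by (simp add: power2_eq_square algebra_simps)
    moreover have "1 + x\<^sup>2 > 0" "1 + (x + 1/2)\<^sup>2 > 0" by (auto intro: add_pos_nonneg)
    ultimately show ?thesis by (simp add: field_simps)
  qed
  have "lattice_weight 1 (l + sharp) \<le> (3 * (1 / (1 + (fst l)\<^sup>2))) * (3 * (1 / (1 + (snd l)\<^sup>2)))"
    unfolding lattice_weight_def using *[of "fst l"] *[of "snd l"]
    by (intro mult_mono) (auto simp: sharp_def)
  thus ?thesis by (simp add: lattice_weight_def)
qed

lemma lattice_weight_summable_Un: "lattice_weight 1 summable_on (Lattice \<union> sharp_Lattice)"
proof -
  have "(\<lambda>l. lattice_weight 1 (l + sharp)) summable_on Lattice"
    using lattice_weight_shift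
    by (intro summable_on_comparison_test[OF summable_on_cmult_right[OF lattice_weight_summable[of 1], of 9]])
       (auto simp: lattice_weight_nonneg)
  hence "lattice_weight 1 summable_on sharp_Lattice"
    unfolding sharp_Lattice_def by (subst summable_on_reindex) (auto simp: o_def)
  thus ?thesis
    using lattice_weight_summable[of 1] Lattice_sharp_disjoint by (intro summable_on_Un_disjoint) auto
qed

text \<open>Put t = |l|. Since pi / 2 \<ge> 1, the Gaussian is at most exp(-t^2): one half of this
  exponent absorbs the growth exp(r t), by r t \<le> r^2/2 + t^2/2, the other half the denominators
  of the weight. Summability over both lattices follows for every r.\<close>

lemma gaussian_le_lattice_weight:
  assumes "r \<ge> 0"
  shows "exp (- pi * (norm l)\<^sup>2 / 2) * exp (r * norm l) \<le> 16 * exp (r\<^sup>2 / 2) * lattice_weight 1 l"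
proof -
  let ?t = "norm l"
  have 1: "1 + ?t\<^sup>2 \<le> 4 * exp (?t\<^sup>2 / 4)"
    using exp_ge_add_one_self[of "?t\<^sup>2 / 4"] zero_le_power2[of ?t] by linarith
  have "(1 + (fst l)\<^sup>2) * (1 + (snd l)\<^sup>2) \<le> (1 + ?t\<^sup>2) * (1 + ?t\<^sup>2)"
    by (intro mult_mono) (auto simp: norm_power2_prod)
  also have "\<dots> \<le> (4 * exp (?t\<^sup>2 / 4)) * (4 * exp (?t\<^sup>2 / 4))"
    using 1 by (intro mult_mono) auto
  also have "\<dots> = 16 * exp (?t\<^sup>2 / 2)"
    by (simp flip: exp_add)
  finally have 2: "(1 + (fst l)\<^sup>2) * (1 + (snd l)\<^sup>2) \<le> 16 * exp (?t\<^sup>2 / 2)" .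
  have "r * ?t \<le> r\<^sup>2 / 2 + ?t\<^sup>2 / 2"
    using sum_squares_bound[of r ?t] by simp
  moreover have "2 * ?t\<^sup>2 \<le> pi * ?t\<^sup>2"
    using pi_gt3 by (intro mult_right_mono) auto
  ultimately have 3: "- pi * ?t\<^sup>2 / 2 + r * ?t + ?t\<^sup>2 / 2 \<le> r\<^sup>2 / 2" by simp
  have "exp (- pi * ?t\<^sup>2 / 2) * exp (r * ?t) * ((1 + (fst l)\<^sup>2) * (1 + (snd l)\<^sup>2))
      \<le> exp (- pi * ?t\<^sup>2 / 2) * exp (r * ?t) * (16 * exp (?t\<^sup>2 / 2))"
    using 2 by (intro mult_left_mono) auto
  also have "\<dots> = 16 * exp (- pi * ?t\<^sup>2 / 2 + r * ?t + ?t\<^sup>2 / 2)"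
    unfolding exp_add by simp
  also have "\<dots> \<le> 16 * exp (r\<^sup>2 / 2)" using 3 by simp
  finally show ?thesis
    by (simp add: lattice_weight_def field_simps add_pos_nonneg)
qed

lemma gaussian_summable:
  assumes "L \<subseteq> Lattice \<union> sharp_Lattice" "r \<ge> 0"
  shows "(\<lambda>l. exp (- pi * (norm l)\<^sup>2 / 2) * exp (r * norm l)) summable_on L"
proof (rule summable_on_subset[OF _ assms(1)])
  show "(\<lambda>l. exp (- pi * (norm l)\<^sup>2 / 2) * exp (r * norm l)) summable_on (Lattice \<union> sharp_Lattice)"
    using gaussian_le_lattice_weight[OF assms(2)]
    by (intro summable_on_comparison_test[OF summable_on_cmult_right[OF lattice_weight_summable_Un]]) auto
qed

section \<open>Overlaps of Gabor functions and exponential sums\<close>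

definition fock_factor :: "real \<times> real \<Rightarrow> complex" where
  "fock_factor l = exp (of_real (- pi * (norm l)\<^sup>2 / 2) + \<i> * of_real (pi * fst l * snd l))"

text \<open>The inner product of \<open>gabor l\<close> with \<open>gabor v\<close> in L2, see
  \<open>integral_gabor_cnj_gabor\<close>.\<close>

definition overlap :: "real \<times> real \<Rightarrow> real \<times> real \<Rightarrow> complex" where
  "overlap l v = exp (of_real (- pi * (norm (l - v))\<^sup>2 / 2)
                    + \<i> * of_real (pi * (fst l + fst v) * (snd l - snd v)))"

lemma norm_fock_factor: "norm (fock_factor l) = exp (- pi * (norm l)\<^sup>2 / 2)"
  by (simp add: fock_factor_def)

lemma fock_factor_nz: "fock_factor l \<noteq> 0"
  by (simp add: fock_factor_def)

lemma norm_overlap: "norm (overlap l v) = exp (- pi * (norm (l - v))\<^sup>2 / 2)"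
  by (simp add: overlap_def)

text \<open>Expanding |l - v|^2 and the phase, all cross terms combine into pi z cnj(w), where z and
  w are the complex forms of l and v; the rest depends on l alone or on v alone. So the overlap is,
  up to these factors, the reproducing kernel of a Fock space.\<close>

lemma overlap_factor: "overlap l v = fock_factor l * cnj (fock_factor v) * exp (to_complex l * (of_real pi * cnj (to_complex v)))"
  unfolding overlap_def fock_factor_def exp_cnj exp_add[symmetric]
  by (rule arg_cong[where f = exp])
     (simp add: complex_eq_iff norm_power2_prod to_complex_def, simp add: power2_eq_square field_simps)

text \<open>Strong induction: once the lower coefficients are 0, dividing by x^n off the origin
  leaves a power series with sum 0, whose limit at the origin is \<open>a n\<close>.\<close>

lemma powser_zero_imp_coeff_zero:
  fixes a :: "nat \<Rightarrow> 'a::{real_normed_field,banach}"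
  assumes "\<And>x. (\<lambda>n. a n * x ^ n) sums 0"
  shows "a n = 0"
proof (induction n rule: less_induct)
  case (less n)
  have "(\<lambda>i. a (i + n) * x ^ i) sums 0" if "x \<noteq> 0" for x
  proof -
    have "(\<lambda>i. a (i + n) * x ^ (i + n)) sums 0"
      using less assms[of x] by (subst sums_iff_shift) auto
    hence "(\<lambda>i. a (i + n) * x ^ (i + n) * inverse (x ^ n)) sums (0 * inverse (x ^ n))"
      by (rule sums_mult2)
    thus ?thesis using that by (simp add: power_add field_simps)
  qed
  hence "((\<lambda>_ :: 'a. 0 :: 'a) \<longlongrightarrow> a (0 + n)) (at 0)"
    by (intro powser_limit_0_strong[where s = 1 and a = "\<lambda>i. a (i + n)" and f = "\<lambda>_. 0"]) auto
  thus ?case using tendsto_unique[OF _ _ tendsto_const] by force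
qed

text \<open>The hypothesis with r = |w| makes the double series over \<open>L\<close> and n
  absolutely convergent, since the exponential series of absolute values sums to exp(|w| |z l|).
  Summing in the other order gives the power series in w, whose coefficients are the moments divided
  by n!.\<close>

lemma exp_sum_powser:
  fixes a z :: "'i \<Rightarrow> complex"
  assumes "\<And>r. r \<ge> 0 \<Longrightarrow> (\<lambda>l. norm (a l) * exp (r * norm (z l))) summable_on L"
  shows "(\<lambda>l. a l * z l ^ n) summable_on L"
    and "(\<lambda>l. a l * exp (z l * w)) summable_on L"
    and "(\<lambda>n. (\<Sum>\<^sub>\<infinity>l\<in>L. a l * z l ^ n) / fact n * w ^ n) sums (\<Sum>\<^sub>\<infinity>l\<in>L. a l * exp (z l * w))"
proof -
  define f where "f w = (\<lambda>(l, n). a l * z l ^ n / fact n * w ^ n)" for w :: complex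
  have nexp: "((\<lambda>n. x ^ n / fact n) has_sum exp x) UNIV" if "x \<ge> 0" for x :: real
    using that exp_converges[of x] by (intro sums_nonneg_imp_has_sum) (auto simp: field_simps scaleR_conv_of_real)
  have cexp: "((\<lambda>n. x ^ n / fact n) has_sum exp x) UNIV" for x :: complex
  proof (rule norm_summable_imp_has_sum)
    show "summable (\<lambda>n. norm (x ^ n / fact n))"
      using summable_norm_exp[of x] by (simp add: field_simps scaleR_conv_of_real norm_mult norm_divide)
    show "(\<lambda>n. x ^ n / fact n) sums exp x"
      using exp_converges[of x] by (simp add: field_simps scaleR_conv_of_real)
  qed
  have abs: "(\<lambda>p. norm (f w p)) summable_on (L \<times> UNIV)" for w
  proof (rule Infinite_Sum.abs_summable_on_Sigma_iff[THEN iffD2], intro conjI ballI)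
    have eq: "norm (f w (l, n)) = norm (a l) * ((norm w * norm (z l)) ^ n / fact n)" for l n
      by (simp add: f_def norm_mult norm_divide norm_power power_mult_distrib)
    have hs: "((\<lambda>n. norm (f w (l, n))) has_sum norm (a l) * exp (norm w * norm (z l))) UNIV" for l
      unfolding eq by (intro has_sum_cmult_right nexp) auto
    show "(\<lambda>n. norm (f w (l, n))) summable_on UNIV" for l
      using hs by (rule has_sum_imp_summable)
    show "(\<lambda>l. norm (\<Sum>\<^sub>\<infinity>n. norm (f w (l, n)))) summable_on L"
      unfolding infsumI[OF hs] using assms[of "norm w"] by simp
  qed
  have smb: "f w summable_on (L \<times> UNIV)" for w
    by (rule abs_summable_summable[OF abs])
  have inner: "((\<lambda>n. f w (l, n)) has_sum (a l * exp (z l * w))) UNIV" for w l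
    using has_sum_cmult_right[OF cexp[of "z l * w"], of "a l"]
    by (simp add: f_def power_mult_distrib mult.assoc)
  have tot: "((\<lambda>l. a l * exp (z l * w)) has_sum infsum (f w) (L \<times> UNIV)) L" for w
    using has_sum_SigmaD[OF has_sum_infsum[OF smb] inner, of w] .
  thus "(\<lambda>l. a l * exp (z l * w)) summable_on L" by (rule has_sum_imp_summable)
  have sw: "((\<lambda>(n, l). f w (l, n)) has_sum infsum (f w) (L \<times> UNIV)) (UNIV \<times> L)" for w
    using has_sum_infsum[OF smb[of w]] by (subst has_sum_swap) simp
  have inner2: "(\<lambda>l. f w (l, n)) summable_on L" for w n
    using summable_on_SigmaD1[OF has_sum_imp_summable[OF sw[of w]], of n] by simp
  show mom: "(\<lambda>l. a l * z l ^ n) summable_on L" for n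
    using summable_on_cmult_right[OF inner2[of 1 n], of "fact n"] by (simp add: f_def)
  have "((\<lambda>l. f w (l, n)) has_sum ((\<Sum>\<^sub>\<infinity>l\<in>L. a l * z l ^ n) / fact n * w ^ n)) L" for n
    using has_sum_cmult_left[OF has_sum_infsum[OF mom[of n]], of "w ^ n / fact n"]
    by (simp add: f_def)
  hence "((\<lambda>n. (\<Sum>\<^sub>\<infinity>l\<in>L. a l * z l ^ n) / fact n * w ^ n) has_sum infsum (f w) (L \<times> UNIV)) UNIV"
    using has_sum_SigmaD[OF sw[of w], of "\<lambda>n. (\<Sum>\<^sub>\<infinity>l\<in>L. a l * z l ^ n) / fact n * w ^ n"] by simp
  thus "(\<lambda>n. (\<Sum>\<^sub>\<infinity>l\<in>L. a l * z l ^ n) / fact n * w ^ n) sums (\<Sum>\<^sub>\<infinity>l\<in>L. a l * exp (z l * w))"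
    unfolding infsumI[OF tot] by (rule has_sum_imp_sums)
qed

section \<open>Gabor functions\<close>

lemma L2_fun_mult_integrable:
  assumes "L2_fun f" "L2_fun g"
  shows "integrable lborel (\<lambda>x. f x * g x)"
proof (rule Bochner_Integration.integrable_bound)
  show "integrable lborel (\<lambda>x. (norm (f x))\<^sup>2 + (norm (g x))\<^sup>2)"
    using assms by (auto simp: L2_fun_def)
  show "(\<lambda>x. f x * g x) \<in> borel_measurable lborel"
    using assms by (auto simp: L2_fun_def)
  have "a * b \<le> a\<^sup>2 + b\<^sup>2" for a b :: real
    using zero_le_power2[of "a - b / 2"] zero_le_power2[of b]
    by (simp add: power2_eq_square algebra_simps) (use zero_le_square[of b] in linarith)
  thus "AE x in lborel. norm (f x * g x) \<le> norm ((norm (f x))\<^sup>2 + (norm (g x))\<^sup>2)"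
    by (auto simp: norm_mult)
qed

lemma L2_fun_add:
  assumes "L2_fun f" "L2_fun g"
  shows "L2_fun (\<lambda>x. f x + g x)"
proof -
  have [measurable]: "f \<in> borel_measurable lborel" "g \<in> borel_measurable lborel"
    using assms by (auto simp: L2_fun_def)
  have "integrable lborel (\<lambda>x. (norm (f x + g x))\<^sup>2)"
  proof (rule Bochner_Integration.integrable_bound)
    show "integrable lborel (\<lambda>x. 2 * (norm (f x))\<^sup>2 + 2 * (norm (g x))\<^sup>2)"
      using assms by (auto simp: L2_fun_def)
    have "(norm (a + b))\<^sup>2 \<le> 2 * (norm a)\<^sup>2 + 2 * (norm b)\<^sup>2" for a b :: complex
    proof -
      have "(norm (a + b))\<^sup>2 \<le> (norm a + norm b)\<^sup>2"
        by (intro power_mono norm_triangle_ineq) auto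
      also have "\<dots> \<le> 2 * (norm a)\<^sup>2 + 2 * (norm b)\<^sup>2"
        using sum_squares_bound[of "norm a" "norm b"] by (simp add: power2_sum)
      finally show ?thesis .
    qed
    thus "AE x in lborel. norm ((norm (f x + g x))\<^sup>2) \<le> norm (2 * (norm (f x))\<^sup>2 + 2 * (norm (g x))\<^sup>2)"
      by auto
  qed auto
  thus ?thesis by (auto simp: L2_fun_def)
qed

lemma L2_fun_cmult: "L2_fun f \<Longrightarrow> L2_fun (\<lambda>x. c * f x)"
  by (auto simp: L2_fun_def norm_mult power_mult_distrib)

lemma L2_fun_sum:
  assumes "finite F" "\<And>i. i \<in> F \<Longrightarrow> L2_fun (f i)"
  shows "L2_fun (\<lambda>x. \<Sum>i\<in>F. f i x)"
  using assms by (induction F rule: finite_induct) (auto intro: L2_fun_add simp: L2_fun_def[of "\<lambda>_. 0"])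

text \<open>Pairing with a fixed L2 function is continuous. A weighted inequality between arithmetic
  and geometric mean, integrated, serves in place of Cauchy-Schwarz.\<close>

lemma has_L2_sum_pairing:
  assumes f: "has_L2_sum f A g" and psi: "L2_fun \<psi>"
  shows "((\<lambda>i. LINT x|lborel. f i x * \<psi> x) has_sum (LINT x|lborel. g x * \<psi> x)) A"
  unfolding has_sum_def
proof (rule tendstoI)
  fix e :: real assume e: "e > 0"
  define P where "P = (LINT x|lborel. (norm (\<psi> x))\<^sup>2)"
  have P: "P \<ge> 0" by (simp add: P_def)
  \<comment> \<open>With this weight an error energy below e t contributes less than e/2, and t P /
    2 is at most e/2; the summand 1 keeps \<open>t\<close> meaningful when P = 0.\<close>
  define t where "t = e / (P + 1)"
  have t: "t > 0" using e P by (simp add: t_def)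
  have L2: "L2_fun (f i)" if "i \<in> A" for i using f that by (simp add: has_L2_sum_def)
  have g: "L2_fun g" using f by (simp add: has_L2_sum_def)
  let ?D = "\<lambda>F x. (\<Sum>i\<in>F. f i x) - g x"
  have "\<forall>\<^sub>F F in finite_subsets_at_top A. dist (LINT x|lborel. (norm (?D F x))\<^sup>2) 0 < e * t"
    using f e t by (intro tendstoD) (auto simp: has_L2_sum_def)
  moreover have "\<forall>\<^sub>F F in finite_subsets_at_top A. finite F \<and> F \<subseteq> A"
    by (rule eventually_finite_subsets_at_top_weakI) auto
  ultimately show "\<forall>\<^sub>F F in finite_subsets_at_top A.
      dist (\<Sum>i\<in>F. LINT x|lborel. f i x * \<psi> x) (LINT x|lborel. g x * \<psi> x) < e"
  proof eventually_elim
    case (elim F)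
    have D: "L2_fun (?D F)"
      using L2_fun_add[OF L2_fun_sum[of F f] L2_fun_cmult[OF g, of "-1"]] elim L2 by auto
    have "(LINT x|lborel. ?D F x * \<psi> x)
        = (LINT x|lborel. (\<Sum>i\<in>F. f i x * \<psi> x) - g x * \<psi> x)"
      by (simp add: left_diff_distrib sum_distrib_right)
    also have "\<dots> = (\<Sum>i\<in>F. LINT x|lborel. f i x * \<psi> x) - (LINT x|lborel. g x * \<psi> x)"
      using elim L2 g psi by (subst Bochner_Integration.integral_diff)
        (auto intro!: L2_fun_mult_integrable Bochner_Integration.integrable_sum Bochner_Integration.integral_sum)
    finally have eq: "(\<Sum>i\<in>F. LINT x|lborel. f i x * \<psi> x) - (LINT x|lborel. g x * \<psi> x)
        = (LINT x|lborel. ?D F x * \<psi> x)" ..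
    have amgm: "a * b \<le> a\<^sup>2 / (2 * t) + t / 2 * b\<^sup>2" for a b :: real
    proof -
      have "0 \<le> (a - t * b)\<^sup>2 / (2 * t)" using t by simp
      also have "\<dots> = a\<^sup>2 / (2 * t) + t / 2 * b\<^sup>2 - a * b"
        using t by (simp add: power2_eq_square field_simps)
      finally show ?thesis by simp
    qed
    have "norm (LINT x|lborel. ?D F x * \<psi> x)
        \<le> (LINT x|lborel. (norm (?D F x))\<^sup>2 / (2 * t) + t / 2 * (norm (\<psi> x))\<^sup>2)"
    proof (rule Bochner_Integration.integral_norm_bound_integral)
      show "integrable lborel (\<lambda>x. ?D F x * \<psi> x)" by (rule L2_fun_mult_integrable[OF D psi])
      show "integrable lborel (\<lambda>x. (norm (?D F x))\<^sup>2 / (2 * t) + t / 2 * (norm (\<psi> x))\<^sup>2)"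
        using D psi by (auto simp: L2_fun_def)
    qed (use amgm in \<open>simp add: norm_mult\<close>)
    also have "\<dots> = (LINT x|lborel. (norm (?D F x))\<^sup>2) / (2 * t) + t / 2 * P"
      using D psi unfolding P_def by (subst Bochner_Integration.integral_add) (auto simp: L2_fun_def)
    also have "\<dots> < e * t / (2 * t) + e / 2"
    proof (rule add_less_le_mono)
      show "(LINT x|lborel. (norm (?D F x))\<^sup>2) / (2 * t) < e * t / (2 * t)"
        using elim t by (intro divide_strict_right_mono) auto
      show "t / 2 * P \<le> e / 2"
        using e P by (simp add: t_def field_simps)
    qed
    also have "\<dots> = e" using t by simp
    finally show ?case by (simp add: dist_norm eq)
  qed
qed

section \<open>Normalisation and inner products\<close>

lemma fourth_root_two: "(2 powr (1/4) :: real) * 2 powr (1/4) = sqrt 2"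
proof -
  have "(2 powr (1/4) :: real) * 2 powr (1/4) = 2 powr (1/4 + 1/4)"
    by (rule powr_add[symmetric])
  thus ?thesis by (simp add: powr_half_sqrt)
qed

text \<open>The factor 2^(1/4) makes \<open>gabor l\<close> a unit vector, so its squared modulus is
  a probability density, of variance 1 / (4 pi). Membership in L2 is read off from this.\<close>

lemma gabor_norm_power2: "(norm (gabor l x))\<^sup>2 = normal_density (fst l) (1 / (2 * sqrt pi)) x"
proof -
  have "(2 powr (1/4) * exp (- (pi * (x - fst l)\<^sup>2)))\<^sup>2 = sqrt 2 * exp (- 2 * pi * (x - fst l)\<^sup>2)"
    by (simp only: power_mult_distrib power2_eq_square[of "2 powr (1/4)"] power2_eq_square[of "exp _"]
        fourth_root_two exp_add[symmetric]) simp
  moreover have "norm (gabor l x) = 2 powr (1/4) * exp (- (pi * (x - fst l)\<^sup>2))"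
    by (simp add: gabor_def case_prod_unfold norm_mult)
  moreover have "normal_density (fst l) (1 / (2 * sqrt pi)) x = sqrt 2 * exp (- 2 * pi * (x - fst l)\<^sup>2)"
    by (simp add: normal_density_def power_divide real_sqrt_divide field_simps)
  ultimately show ?thesis by simp
qed

lemma gabor_L2: "L2_fun (gabor l)"
proof -
  have "gabor l \<in> borel_measurable lborel"
    unfolding gabor_def case_prod_unfold by measurable
  thus ?thesis unfolding L2_fun_def gabor_norm_power2 by auto
qed

lemma L2_fun_cnj: "L2_fun f \<Longrightarrow> L2_fun (\<lambda>x. cnj (f x))"
  unfolding L2_fun_def complex_mod_cnj
  by (auto intro!: borel_measurable_continuous_on[of cnj] continuous_intros)

lemma integral_gaussian_iexp:
  "(LINT x|lborel. std_normal_density x *\<^sub>R iexp (t * x)) = of_real (exp (- t\<^sup>2 / 2))"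
proof -
  have "(LINT x|lborel. std_normal_density x *\<^sub>R iexp (t * x)) = char std_normal_distribution t"
    unfolding char_def by (subst integral_density) auto
  thus ?thesis by (simp add: char_std_normal_distribution)
qed

text \<open>The product of Gaussians centred at p and q is exp(-pi (p - q)^2 / 2) times a Gaussian
  around the midpoint \<open>a\<close>. The substitution x = a + y / (2 sqrt pi) makes the latter
  standard normal, and its characteristic function at t sqrt pi accounts for the difference t of the
  frequencies.\<close>

lemma integral_gabor_cnj_gabor: "(LINT x|lborel. gabor l x * cnj (gabor v x)) = overlap l v"
proof -
  define p q t where "p = fst l" and "q = fst v" and "t = snd l - snd v"
  define a where "a = (p + q) / 2"
  define s where "s = sqrt pi"
  have s: "s > 0" "s * s = pi" by (auto simp: s_def)
  define C :: complex where "C = of_real (sqrt 2 * sqrt (2 * pi) * exp (- pi * (p - q)\<^sup>2 / 2)) * exp (\<i> * of_real (2 * pi * t * a))"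
  have pw: "gabor l x * cnj (gabor v x) = of_real (sqrt 2) *
      exp (of_real (- pi * ((x - p)\<^sup>2 + (x - q)\<^sup>2)) + \<i> * of_real (2 * pi * t * x))" for x
  proof -
    have "gabor l x * cnj (gabor v x) = of_real (2 powr (1/4) * 2 powr (1/4)) *
      exp (of_real (- pi * ((x - p)\<^sup>2 + (x - q)\<^sup>2)) + \<i> * of_real (2 * pi * t * x))"
      by (simp add: gabor_def case_prod_unfold p_def q_def t_def exp_cnj exp_add[symmetric] algebra_simps
          flip: exp_add)
    thus ?thesis by (simp only: fourth_root_two)
  qed
  have sh: "gabor l (a + 1 / (2 * s) * y) * cnj (gabor v (a + 1 / (2 * s) * y))
      = C * (std_normal_density y *\<^sub>R iexp (t * s * y))" for y
  proof -
    have e1: "- pi * ((a + 1 / (2 * s) * y - p)\<^sup>2 + (a + 1 / (2 * s) * y - q)\<^sup>2)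
        = - pi * (p - q)\<^sup>2 / 2 + - y\<^sup>2 / 2"
      unfolding s(2)[symmetric] a_def using s(1) by (simp add: power2_eq_square field_simps)
    have e2: "2 * pi * t * (a + 1 / (2 * s) * y) = 2 * pi * t * a + t * s * y"
      unfolding s(2)[symmetric] using s(1) by (simp add: field_simps)
    have "exp (- y\<^sup>2 / 2) = sqrt (2 * pi) * std_normal_density y"
      unfolding std_normal_density_def by simp
    hence B: "(of_real (exp (- y\<^sup>2 / 2)) :: complex) = of_real (sqrt (2 * pi)) * of_real (std_normal_density y)"
      by (metis of_real_mult)
    show ?thesis
      unfolding pw e1 e2 C_def
      unfolding of_real_add distrib_left exp_add exp_of_real scaleR_conv_of_real B of_real_mult
      by (simp only: mult_ac)
  qed
  have "(LINT x|lborel. gabor l x * cnj (gabor v x)) =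
      \<bar>1 / (2 * s)\<bar> *\<^sub>R (LINT y|lborel. C * (std_normal_density y *\<^sub>R iexp (t * s * y)))"
    unfolding sh[symmetric] using s by (intro lborel_integral_real_affine) auto
  also have "\<dots> = of_real \<bar>1 / (2 * s)\<bar> * (C * of_real (exp (- (t * s)\<^sup>2 / 2)))"
    unfolding integral_mult_right_zero integral_gaussian_iexp
    unfolding scaleR_conv_of_real ..
  also have "\<dots> = of_real (exp (- pi * (p - q)\<^sup>2 / 2) * exp (- (t * s)\<^sup>2 / 2)) * exp (\<i> * of_real (2 * pi * t * a))"
  proof -
    \<comment> \<open>The Jacobian of the substitution cancels the constant sqrt 2 of the two Gabor
      functions and the sqrt (2 pi) of the normal density.\<close>
    have "\<bar>1 / (2 * s)\<bar> * (sqrt 2 * sqrt (2 * pi)) = 1"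
      using s by (simp add: real_sqrt_mult s_def)
    hence "of_real (\<bar>1 / (2 * s)\<bar> * (sqrt 2 * sqrt (2 * pi))) = (of_real 1 :: complex)"
      by (rule arg_cong)
    hence k: "(of_real \<bar>1 / (2 * s)\<bar> * (of_real (sqrt 2) * of_real (sqrt (2 * pi))) :: complex) = 1"
      by (simp only: of_real_mult of_real_1)
    have "of_real \<bar>1 / (2 * s)\<bar> * (C * of_real (exp (- (t * s)\<^sup>2 / 2)))
        = (of_real \<bar>1 / (2 * s)\<bar> * (of_real (sqrt 2) * of_real (sqrt (2 * pi)))) *
          (of_real (exp (- pi * (p - q)\<^sup>2 / 2) * exp (- (t * s)\<^sup>2 / 2)) * exp (\<i> * of_real (2 * pi * t * a)))"
      unfolding C_def of_real_mult by (simp only: mult_ac)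
    thus ?thesis by (simp only: k mult_1_left)
  qed
  also have "\<dots> = overlap l v"
  proof -
    have "(t * s)\<^sup>2 = pi * t\<^sup>2" using s by (simp add: power2_eq_square)
    hence 1: "- pi * (p - q)\<^sup>2 / 2 + - (t * s)\<^sup>2 / 2 = - pi * (norm (l - v))\<^sup>2 / 2"
      by (simp add: norm_power2_prod p_def q_def t_def field_simps)
    have 2: "2 * pi * t * a = pi * (fst l + fst v) * (snd l - snd v)"
      by (simp add: p_def q_def t_def a_def)
    show ?thesis
      unfolding overlap_def exp_add[symmetric] 1 2 exp_of_real[symmetric] ..
  qed
  finally show ?thesis .
qed

section \<open>The annihilation operator and the sharp Poisson functional on Gabor functions\<close>

lemma annihilation_gabor_comb:
  "annihilation (gabor_comb m \<mu> a) = gabor_comb m \<mu> (\<lambda>s. a s * to_complex (\<mu> s))"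
proof
  fix x
  \<comment> \<open>The logarithmic derivative is -2 pi (x - p) + 2 pi i \<theta>. Divided by 2 pi
    and increased by x it becomes p + i \<theta>, so \<open>gabor l\<close> is an
    eigenfunction.\<close>
  have d: "(gabor l has_vector_derivative
      gabor l x * (of_real (- 2 * pi * (x - fst l)) + 2 * of_real pi * \<i> * of_real (snd l))) (at x)" for l
  proof -
    let ?e = "\<lambda>x. - of_real (pi * (x - fst l)\<^sup>2) + 2 * of_real pi * \<i> * of_real (snd l * x)"
    have "((\<lambda>x. pi * (x - fst l)\<^sup>2) has_real_derivative 2 * pi * (x - fst l)) (at x)"
      by (auto intro!: derivative_eq_intros)
    moreover have "((\<lambda>x. snd l * x) has_real_derivative snd l) (at x)"
      by (auto intro!: derivative_eq_intros)
    ultimately have "(?e has_vector_derivative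
        - of_real (2 * pi * (x - fst l)) + 2 * of_real pi * \<i> * of_real (snd l)) (at x)"
      by (intro has_vector_derivative_add has_vector_derivative_minus has_vector_derivative_mult_right
          has_vector_derivative_of_real)
    from field_vector_diff_chain_at[OF this DERIV_exp]
    have "((\<lambda>x. of_real (2 powr (1/4)) * exp (?e x)) has_vector_derivative of_real (2 powr (1/4)) *
        ((- of_real (2 * pi * (x - fst l)) + 2 * of_real pi * \<i> * of_real (snd l)) * exp (?e x))) (at x)"
      by (intro has_vector_derivative_mult_right) (simp add: o_def)
    thus ?thesis
      unfolding gabor_def[abs_def] case_prod_unfold by (simp add: mult_ac)
  qed
  have "(gabor_comb m \<mu> a has_vector_derivative
      (\<Sum>s\<le>m. a s * (gabor (\<mu> s) x * (of_real (- 2 * pi * (x - fst (\<mu> s))) + 2 * of_real pi * \<i> * of_real (snd (\<mu> s)))))) (at x)"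
    unfolding gabor_comb_def[abs_def]
    by (intro has_vector_derivative_sum has_vector_derivative_mult_right d)
  hence v: "vector_derivative (gabor_comb m \<mu> a) (at x) =
      (\<Sum>s\<le>m. a s * (gabor (\<mu> s) x * (of_real (- 2 * pi * (x - fst (\<mu> s))) + 2 * of_real pi * \<i> * of_real (snd (\<mu> s)))))"
    by (rule vector_derivative_at)
  show "annihilation (gabor_comb m \<mu> a) x = gabor_comb m \<mu> (\<lambda>s. a s * to_complex (\<mu> s)) x"
    unfolding annihilation_def v gabor_comb_def sum_divide_distrib sum_distrib_left sum.distrib[symmetric]
    by (intro sum.cong refl) (simp add: to_complex_def complex_eq_iff[of "Complex _ _"] Complex_eq field_simps)
qed

lemma annihilation_funpow_gabor_comb:
  "(annihilation ^^ k) (gabor_comb m \<mu> a) = gabor_comb m \<mu> (\<lambda>s. a s * to_complex (\<mu> s) ^ k)"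
  by (induction k) (simp_all add: annihilation_gabor_comb mult_ac)

text \<open>The value of \<open>sharp_Poisson\<close> on \<open>gabor v\<close> for a sharp point
  \<open>v\<close>, when \<open>Theta 0\<close> is nonzero. It is (-1)^b if the second coordinate is
  b + 1/2.\<close>

definition sharp_sign :: "real \<times> real \<Rightarrow> complex" where
  "sharp_sign v = exp (\<i> * of_real (pi * (snd v - 1/2)))"

lemma exp_i_pi_int: "exp (\<i> * of_real (pi * of_int n)) = (-1) powi n"
proof -
  have "exp (\<i> * of_real pi) powi n = exp (of_int n * (\<i> * of_real pi))"
    by (rule exp_power_int)
  thus ?thesis by (simp add: mult_ac)
qed

lemma gaussian_summable_int: "(\<lambda>q::int. exp (- pi * (of_int q)\<^sup>2 / 2)) summable_on UNIV"
proof -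
  have "(\<lambda>l. exp (- pi * (norm l)\<^sup>2 / 2) * exp (0 * norm l)) summable_on range (\<lambda>q::int. (of_int q :: real, 0 :: real))"
    by (rule gaussian_summable) (auto simp: Lattice_def)
  thus ?thesis
    by (subst (asm) summable_on_reindex) (auto simp: o_def inj_on_def norm_power2_prod)
qed

text \<open>At x = q + 1/2 the phase of \<open>gabor v\<close> is pi q + pi b + pi/2 modulo 2 pi.
  Its first part cancels the alternating sign, and what remains is the series of
  \<open>Theta 0\<close>, shifted by the integer a.\<close>

lemma gabor_alternating_has_sum:
  assumes "v \<in> sharp_Lattice"
  shows "((\<lambda>q::int. (-1) powi q * gabor v (of_int q + 1/2)) has_sum (\<i> * sharp_sign v * Theta 0)) UNIV"
proof -
  obtain a b where v: "v = (of_int a + 1/2, of_int b + 1/2)"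
    using assms by (rule sharp_LatticeE)
  let ?E = "\<lambda>q::int. of_real (exp (- pi * (of_int q)\<^sup>2)) :: complex"
  have "(\<lambda>q::int. exp (- pi * (of_int q)\<^sup>2 / 2)) summable_on UNIV"
    by (rule gaussian_summable_int)
  hence "(\<lambda>q::int. exp (- pi * (of_int q)\<^sup>2)) summable_on UNIV"
    by (rule summable_on_comparison_test) auto
  hence "?E summable_on UNIV"
    by (rule summable_on_of_real)
  moreover have T: "Theta 0 = of_real (2 powr (1/4)) * infsum ?E UNIV"
    by (simp add: Theta_def exp_of_real[symmetric])
  ultimately have "((\<lambda>q. of_real (2 powr (1/4)) * ?E q) has_sum Theta 0) UNIV"
    by (simp add: has_sum_cmult_right)
  hence "((\<lambda>q. of_real (2 powr (1/4)) * ?E (q - a)) has_sum Theta 0) UNIV"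
    by (subst has_sum_reindex_bij_witness[where i = "\<lambda>q. q + a" and j = "\<lambda>q. q - a"]) auto
  hence *: "((\<lambda>q. (\<i> * sharp_sign v) * (of_real (2 powr (1/4)) * ?E (q - a))) has_sum (\<i> * sharp_sign v * Theta 0)) UNIV"
    by (rule has_sum_cmult_right)
  have "(-1) powi q * gabor v (of_int q + 1/2) = (\<i> * sharp_sign v) * (of_real (2 powr (1/4)) * ?E (q - a))" for q
  proof -
    have ph: "2 * pi * ((of_int b + 1/2) * (of_int q + 1/2)) = pi * of_int (2 * b * q) + pi * of_int q + pi * of_int b + pi / 2"
      by (simp add: field_simps)
    have "exp (2 * of_real pi * \<i> * of_real ((of_int b + 1/2) * (of_int q + 1/2)))
        = exp (\<i> * of_real (2 * pi * ((of_int b + 1/2) * (of_int q + 1/2))))"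
      by (simp only: of_real_mult of_real_numeral mult_ac)
    also have "\<dots> = exp (\<i> * of_real (pi * of_int (2 * b * q))) * exp (\<i> * of_real (pi * of_int q))
        * exp (\<i> * of_real (pi * of_int b)) * exp (\<i> * of_real (pi / 2))"
      by (subst ph) (simp only: of_real_add distrib_left exp_add)
    also have "\<dots> = (-1) powi q * (-1) powi b * \<i>"
    proof -
      have "exp (\<i> * of_real (pi / 2)) = \<i>"
        by (metis cis_conv_exp cis_pi_half)
      moreover have "(-1 :: complex) powi (2 * b * q) = 1"
        by (subst power_int_minus_left_even) auto
      ultimately show ?thesis unfolding exp_i_pi_int by (simp only: mult_1_left)
    qed
    finally have E: "exp (2 * of_real pi * \<i> * of_real ((of_int b + 1/2) * (of_int q + 1/2)))
        = (-1) powi q * (-1) powi b * \<i>" .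
    have c: "sharp_sign v = (-1) powi b"
      unfolding v sharp_sign_def using exp_i_pi_int[of b] by simp
    have "((-1) powi q * (-1) powi q :: complex) = 1"
      by (simp flip: power_int_mult_distrib)
    moreover have "gabor v (of_int q + 1/2) = of_real (2 powr (1/4)) * (?E (q - a) * ((-1) powi q * (-1) powi b * \<i>))"
      unfolding gabor_def v prod.case exp_add E by (simp add: exp_of_real[symmetric])
    ultimately show ?thesis unfolding c by (simp add: mult_ac)
  qed
  thus ?thesis using * by simp
qed

lemma has_sum_finite_sum:
  fixes f :: "'i \<Rightarrow> 'a \<Rightarrow> 'b::topological_comm_monoid_add"
  assumes "finite F" "\<And>i. i \<in> F \<Longrightarrow> (f i has_sum S i) A"
  shows "((\<lambda>x. \<Sum>i\<in>F. f i x) has_sum (\<Sum>i\<in>F. S i)) A"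
  using assms by (induction F rule: finite_induct) (auto intro: has_sum_add)

lemma sharp_Poisson_gabor_comb:
  assumes "\<mu> ` {..m} \<subseteq> sharp_Lattice" "Theta 0 \<noteq> 0"
  shows "sharp_Poisson (gabor_comb m \<mu> a) = (\<Sum>s\<le>m. a s * sharp_sign (\<mu> s))"
proof -
  have "((\<lambda>q::int. \<Sum>s\<le>m. a s * ((-1) powi q * gabor (\<mu> s) (of_int q + 1/2))) has_sum
      (\<Sum>s\<le>m. a s * (\<i> * sharp_sign (\<mu> s) * Theta 0))) UNIV"
    using assms by (intro has_sum_finite_sum has_sum_cmult_right gabor_alternating_has_sum) auto
  hence "((\<lambda>q::int. (-1) powi q * gabor_comb m \<mu> a (of_int q + 1/2)) has_sum
      (\<Sum>s\<le>m. a s * sharp_sign (\<mu> s)) * (\<i> * Theta 0)) UNIV"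
    by (simp add: gabor_comb_def sum_distrib_left sum_distrib_right mult_ac)
  from infsumI[OF this] show ?thesis
    using assms(2) by (simp add: sharp_Poisson_def)
qed

text \<open>If \<open>Theta 0\<close> were 0, the convention 1 / 0 = 0 would make
  \<open>sharp_Poisson\<close> the zero functional, against the defining equation for k = j =
  0.\<close>

lemma Theta_0_nonzero:
  assumes "dual_coeffs m \<mu> h"
  shows "Theta 0 \<noteq> 0"
proof
  assume "Theta 0 = 0"
  hence "\<forall>k\<le>m. \<forall>j\<le>m. (if k = j then 1 else 0) = (0::complex)"
    using assms by (simp add: dual_coeffs_def sharp_Poisson_def)
  from this[rule_format, of 0 0] show False by simp
qed

section \<open>A twisted theta constant\<close>

text \<open>Doubling the coordinates turns both cosets into sets of integer pairs, with entries
  bounded here by 2 r.\<close>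

lemma finite_lattice_ball: "finite {l \<in> Lattice \<union> sharp_Lattice. norm l \<le> r}"
proof -
  define n where "n = \<lceil>2 * r\<rceil>"
  have "{l \<in> Lattice \<union> sharp_Lattice. norm l \<le> r} \<subseteq> (\<lambda>(a, b). (of_int a / 2, of_int b / 2)) ` ({-n..n} \<times> {-n..n})"
  proof (rule subsetI)
    fix l assume "l \<in> {l \<in> Lattice \<union> sharp_Lattice. norm l \<le> r}"
    moreover obtain p t where l_eq: "l = (p, t)" by (cases l)
    ultimately have l: "(p, t) \<in> Lattice \<union> sharp_Lattice" and r: "norm (p, t) \<le> r" by auto
    obtain a b where ab: "p = of_int a / 2" "t = of_int b / 2"
    proof (cases "(p, t) \<in> Lattice")
      case True
      then obtain a b where "p = of_int a" "t = of_int b" by (auto elim: LatticeE)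
      thus ?thesis by (intro that[of "2 * a" "2 * b"]) auto
    next
      case False
      with l obtain a b where "p = of_int a + 1/2" "t = of_int b + 1/2" by (auto elim: sharp_LatticeE)
      thus ?thesis by (intro that[of "2 * a + 1" "2 * b + 1"]) (auto simp: add_divide_distrib)
    qed
    have "\<bar>p\<bar> \<le> r" "\<bar>t\<bar> \<le> r"
      using r norm_fst_le[of p t] norm_snd_le[of t p] by auto
    hence "\<bar>of_int a\<bar> \<le> 2 * r" "\<bar>of_int b\<bar> \<le> 2 * r" unfolding ab by auto
    hence "\<bar>a\<bar> \<le> n" "\<bar>b\<bar> \<le> n" unfolding n_def by linarith+
    thus "l \<in> (\<lambda>(a, b). (of_int a / 2, of_int b / 2)) ` ({-n..n} \<times> {-n..n})"
      unfolding l_eq ab by (intro image_eqI[of _ _ "(a, b)"]) auto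
  qed
  thus ?thesis by (rule finite_subset) auto
qed

section \<open>Translations and reflections of the lattice and its sharp coset\<close>

lemma Lattice_diff: "l \<in> Lattice \<Longrightarrow> l' \<in> Lattice \<Longrightarrow> l - l' \<in> Lattice"
  by (auto simp: Lattice_def)

lemma Lattice_add: "l \<in> Lattice \<Longrightarrow> l' \<in> Lattice \<Longrightarrow> l + l' \<in> Lattice"
  by (auto simp: Lattice_def)

lemma sharp_Lattice_iff: "v \<in> sharp_Lattice \<longleftrightarrow> v - sharp \<in> Lattice"
  unfolding sharp_Lattice_def by (auto intro: rev_image_eqI[of "v - sharp"])

lemma sharp_Lattice_diff: "v \<in> sharp_Lattice \<Longrightarrow> w \<in> sharp_Lattice \<Longrightarrow> v - w \<in> Lattice"
  unfolding sharp_Lattice_iff using Lattice_diff[of "v - sharp" "w - sharp"] by simp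

lemma sharp_Lattice_add: "v \<in> sharp_Lattice \<Longrightarrow> l \<in> Lattice \<Longrightarrow> v + l \<in> sharp_Lattice"
  unfolding sharp_Lattice_iff using Lattice_add[of "v - sharp" l] by (simp only: diff_add_eq)

lemma sharp_Lattice_diff_Lattice: "v \<in> sharp_Lattice \<Longrightarrow> l \<in> Lattice \<Longrightarrow> v - l \<in> sharp_Lattice"
  unfolding sharp_Lattice_iff using Lattice_diff[of "v - sharp" l] by (simp add: diff_diff_eq add.commute[of l])

text \<open>The sharp coset is its own negative, because \<open>sharp + sharp\<close> = (1, 1) is a
  lattice point.\<close>

lemma sharp_Lattice_reflect: "v \<in> sharp_Lattice \<Longrightarrow> l \<in> Lattice \<Longrightarrow> l + l - v \<in> sharp_Lattice"
proof -
  assume v: "v \<in> sharp_Lattice" and l: "l \<in> Lattice"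
  have "(1, 1) \<in> Lattice" by (simp add: Lattice_def)
  from Lattice_diff[OF Lattice_diff[OF Lattice_add[OF l l] v[unfolded sharp_Lattice_iff]] this]
  have "l + l - (v - sharp) - (1, 1) \<in> Lattice" .
  moreover have "l + l - (v - sharp) - (1, 1) = l + l - v - sharp"
    by (simp add: prod_eq_iff sharp_def)
  ultimately show ?thesis unfolding sharp_Lattice_iff by simp
qed

lemma gaussian_shift_summable:
  assumes "l \<in> Lattice \<union> sharp_Lattice" "r \<ge> 0"
  shows "(\<lambda>v. exp (- pi * (norm (l - v))\<^sup>2 / 2) * exp (r * norm (l - v))) summable_on sharp_Lattice"
proof -
  have "(\<lambda>v. v - l) ` sharp_Lattice \<subseteq> Lattice \<union> sharp_Lattice"
    using assms(1) sharp_Lattice_diff sharp_Lattice_diff_Lattice by blast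
  from gaussian_summable[OF this assms(2)] show ?thesis
    by (subst (asm) summable_on_reindex) (auto simp: o_def inj_on_def norm_minus_commute)
qed

section \<open>Signs and phases of the terms of the sharp functional\<close>

lemma minus_one_powi: "(-1 :: 'a :: field) powi m = (if even m then 1 else -1)"
  by (simp add: power_int_minus_left)

lemma sharp_sign_mult_overlap:
  "sharp_sign v * overlap l v = of_real (exp (- pi * (norm (l - v))\<^sup>2 / 2)) *
     exp (\<i> * of_real (pi * ((fst l + fst v) * (snd l - snd v) + (snd v - 1/2))))"
proof -
  have ph: "pi * ((fst l + fst v) * (snd l - snd v) + (snd v - 1/2))
      = pi * (fst l + fst v) * (snd l - snd v) + pi * (snd v - 1/2)"
    by (simp add: distrib_left)
  show ?thesis
    unfolding ph unfolding sharp_sign_def overlap_def exp_of_real[symmetric] of_real_add distrib_left exp_add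
    by (simp only: mult_ac)
qed

lemma norm_sharp_sign_mult_overlap: "norm (sharp_sign v * overlap l v) = exp (- pi * (norm (l - v))\<^sup>2 / 2)"
  by (simp add: norm_mult norm_overlap sharp_sign_def)

lemma exp_i_pi_add_int:
  "exp (\<i> * of_real (pi * (x + of_int n))) = exp (\<i> * of_real (pi * x)) * (-1) powi n"
  unfolding exp_i_pi_int[symmetric] exp_add[symmetric] distrib_left of_real_add ..

text \<open>Reflection in l keeps the distance to l and changes the phase by pi times (2(d - b) +
  1)(2a - 1), an odd integer.\<close>

lemma sharp_sign_mult_overlap_reflect:
  assumes "l \<in> Lattice" "v \<in> sharp_Lattice"
  shows "sharp_sign (l + l - v) * overlap l (l + l - v) = - (sharp_sign v * overlap l v)"
proof -
  obtain a b where l: "l = (of_int a, of_int b)" using assms(1) by (rule LatticeE)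
  obtain c d where v: "v = (of_int c + 1/2, of_int d + 1/2)" using assms(2) by (rule sharp_LatticeE)
  let ?w = "l + l - v"
  have ph: "(fst l + fst ?w) * (snd l - snd ?w) + (snd ?w - 1/2)
    = ((fst l + fst v) * (snd l - snd v) + (snd v - 1/2)) + of_int ((2 * (d - b) + 1) * (2 * a - 1))"
    by (simp add: l v algebra_simps)
  have nm: "norm (l - ?w) = norm (l - v)"
    by (subst norm_minus_commute) (simp only: diff_diff_eq2 add_diff_cancel_left' add_diff_eq[symmetric] diff_add_eq)
  have od: "(-1 :: complex) powi ((2 * (d - b) + 1) * (2 * a - 1)) = -1"
    by (subst power_int_minus_left_odd) auto
  show ?thesis unfolding sharp_sign_mult_overlap nm ph exp_i_pi_add_int od by (simp only: mult_minus_right mult_1_right)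
qed

text \<open>Apart from the phase of \<open>sharp_sign l\<close>, the phase is pi times an integer of
  the parity of n k, whichever sharp point l is. So the terms seen from any sharp point form the
  same real double sequence up to a sign.\<close>

lemma sharp_sign_mult_overlap_translate:
  assumes "l \<in> sharp_Lattice"
  shows "sharp_sign (l + (of_int n, of_int k)) * overlap l (l + (of_int n, of_int k))
    = sharp_sign l * of_real ((-1) powi (n * k) * (exp (- pi * (of_int n)\<^sup>2 / 2) * exp (- pi * (of_int k)\<^sup>2 / 2)))"
proof -
  obtain a b where l: "l = (of_int a + 1/2, of_int b + 1/2)" using assms by (rule sharp_LatticeE)
  let ?w = "l + (of_int n, of_int k)"
  have ph: "(fst l + fst ?w) * (snd l - snd ?w) + (snd ?w - 1/2)
    = (snd l - 1/2) + of_int (n * k + 2 * (- n * k - a * k))"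
    by (simp add: l algebra_simps)
  have "even (n * k + 2 * (- n * k - a * k)) = even (n * k)" by presburger
  hence sg: "(-1 :: complex) powi (n * k + 2 * (- n * k - a * k)) = of_real ((-1) powi (n * k))"
    unfolding minus_one_powi by simp
  have nm: "norm (l - ?w) = norm (of_int n :: real, of_int k :: real)"
    by (subst norm_minus_commute) (simp only: add_diff_cancel_left')
  have ex: "exp (- pi * (norm (of_int n :: real, of_int k :: real))\<^sup>2 / 2)
      = exp (- pi * (of_int n)\<^sup>2 / 2) * exp (- pi * (of_int k)\<^sup>2 / 2)"
    unfolding exp_add[symmetric] norm_power2_prod fst_conv snd_conv
    by (rule arg_cong[where f = exp]) (simp add: field_simps)
  show ?thesis
    unfolding sharp_sign_mult_overlap ph exp_i_pi_add_int sg nm ex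
    unfolding sharp_sign_def of_real_mult by (simp only: mult_ac)
qed

text \<open>For sharp l, the factor between \<open>sharp_sign l\<close> and the sum of
  \<open>sharp_sign v * overlap l v\<close> over all sharp v. To recover \<open>sharp_sign l\<close>
  from such sums it must be nonzero.\<close>

definition twisted_theta :: real where
  "twisted_theta = (\<Sum>\<^sub>\<infinity>(n, k) \<in> UNIV \<times> UNIV. (-1) powi (n * k) *
     (exp (- pi * (of_int n)\<^sup>2 / 2) * exp (- pi * (of_int k)\<^sup>2 / 2)))"

text \<open>Each odd term is at most half of its even neighbour nearer to 0, hence at most the mean
  of both even neighbours. Summed over all odd places, these means give exactly the even
  part.\<close>

lemma alternating_gaussian_nonneg: "(\<Sum>\<^sub>\<infinity>k::int. (-1) powi k * exp (- pi * (of_int k)\<^sup>2 / 2)) \<ge> (0::real)"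
proof -
  define g :: "int \<Rightarrow> real" where "g k = exp (- pi * (of_int k)\<^sup>2 / 2)" for k
  have g: "g summable_on A" for A
    using summable_on_subset[OF gaussian_summable_int, of A] by (simp add: g_def[abs_def])
  have gsh: "(\<lambda>k. g (2 * k + j)) summable_on UNIV" for j
    using g[of "range (\<lambda>k. 2 * k + j)"] by (subst (asm) summable_on_reindex) (auto simp: o_def inj_on_def)
  have mid: "g (2 * k + 1) \<le> (g (2 * k) + g (2 * k + 2)) / 2" for k
  proof -
    \<comment> \<open>Raising the square by at least 1 multiplies the Gaussian by at most exp(-pi/2)
      \<le> exp(-1) \<le> 1/2.\<close>
    have step: "g m \<le> g n / 2" if "m\<^sup>2 \<ge> n\<^sup>2 + 1" for m n :: int
    proof -
      have "real_of_int (m\<^sup>2) \<ge> real_of_int (n\<^sup>2 + 1)" using that by (rule of_int_le_iff[THEN iffD2])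
      hence "pi * ((of_int n)\<^sup>2 + 1) \<le> pi * (of_int m)\<^sup>2"
        by (intro mult_left_mono) auto
      hence "- pi * (of_int m)\<^sup>2 / 2 \<le> - pi * (of_int n)\<^sup>2 / 2 - 1"
        using pi_gt3 by (simp add: algebra_simps)
      hence "g m \<le> exp (- pi * (of_int n)\<^sup>2 / 2 - 1)" by (simp add: g_def)
      also have "\<dots> = g n / exp 1" by (simp only: exp_diff g_def)
      also have "\<dots> \<le> g n / 2"
        using exp_ge_add_one_self[of 1] by (intro divide_left_mono) (auto simp: g_def)
      finally show ?thesis .
    qed
    have pos: "g j \<ge> 0" for j by (simp add: g_def)
    show ?thesis
    proof (cases "k \<ge> 0")
      case True
      hence "g (2 * k + 1) \<le> g (2 * k) / 2" by (intro step) (simp add: power2_eq_square algebra_simps)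
      thus ?thesis using pos[of "2 * k + 2"] by simp
    next
      case False
      hence "g (2 * k + 1) \<le> g (2 * k + 2) / 2" by (intro step) (simp add: power2_eq_square algebra_simps)
      thus ?thesis using pos[of "2 * k"] by simp
    qed
  qed
  have shift: "(\<Sum>\<^sub>\<infinity>k. g (2 * k + 2)) = (\<Sum>\<^sub>\<infinity>k. g (2 * k))"
    by (rule infsum_reindex_bij_witness[where i = "\<lambda>k. k - 1" and j = "\<lambda>k. k + 1"]) (auto simp: algebra_simps)
  have "(\<Sum>\<^sub>\<infinity>k. g (2 * k + 1)) \<le> (\<Sum>\<^sub>\<infinity>k. 1/2 * (g (2 * k) + g (2 * k + 2)))"
    using gsh[of 1] gsh[of 0] gsh[of 2] mid
    by (intro infsum_mono summable_on_cmult_right summable_on_add) auto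
  also have "\<dots> = (\<Sum>\<^sub>\<infinity>k. g (2 * k))"
    using gsh[of 0] gsh[of 2] by (subst infsum_cmult_right') (simp add: infsum_add shift)
  finally have le: "(\<Sum>\<^sub>\<infinity>k. g (2 * k + 1)) \<le> (\<Sum>\<^sub>\<infinity>k. g (2 * k))" .
  have ev: "((\<lambda>k. (-1) powi k * g k) has_sum (\<Sum>\<^sub>\<infinity>k. g (2 * k))) (range (\<lambda>k. 2 * k))"
    using gsh[of 0] by (subst has_sum_reindex) (auto simp: o_def inj_on_def minus_one_powi)
  have od: "((\<lambda>k. (-1) powi k * g k) has_sum - (\<Sum>\<^sub>\<infinity>k. g (2 * k + 1))) (range (\<lambda>k. 2 * k + 1))"
    using gsh[of 1] by (subst has_sum_reindex) (auto simp: o_def inj_on_def minus_one_powi has_sum_uminus)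
  have "range (\<lambda>k. 2 * k) \<union> range (\<lambda>k. 2 * k + 1) = (UNIV :: int set)"
    by (auto simp: image_iff) presburger
  moreover have "range (\<lambda>k. 2 * k) \<inter> range (\<lambda>k. 2 * k + 1) = ({} :: int set)"
    by auto presburger
  ultimately have "((\<lambda>k. (-1) powi k * g k) has_sum ((\<Sum>\<^sub>\<infinity>k. g (2 * k)) + - (\<Sum>\<^sub>\<infinity>k. g (2 * k + 1)))) UNIV"
    using has_sum_Un_disjoint[OF ev od] by simp
  from infsumI[OF this] le show ?thesis by (simp add: g_def)
qed

lemma twisted_theta_summable:
  "(\<lambda>(n, k). (-1) powi (n * k) * (exp (- pi * (of_int n)\<^sup>2 / 2) * exp (- pi * (of_int k)\<^sup>2 / 2)) :: real)
     summable_on UNIV \<times> UNIV"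
proof -
  have *: "\<bar>(-1) powi m :: real\<bar> = 1" for m :: int by (simp add: minus_one_powi)
  define g :: "int \<Rightarrow> real" where "g k = exp (- pi * (of_int k)\<^sup>2 / 2)" for k
  have gs: "g summable_on UNIV" using gaussian_summable_int by (simp add: g_def[abs_def])
  have gp: "g k \<ge> 0" for k by (simp add: g_def)
  have "(\<lambda>(n, k). g n * g k) summable_on UNIV \<times> UNIV"
    by (rule summable_on_SigmaI[where g = "\<lambda>n. g n * infsum g UNIV"])
       (auto intro!: has_sum_cmult_right has_sum_infsum summable_on_cmult_left gs simp: gp)
  hence "(\<lambda>x. norm ((\<lambda>(n, k). (-1) powi (n * k) * (g n * g k)) x)) summable_on UNIV \<times> UNIV"
    by (simp add: case_prod_unfold abs_mult * gp)
  from abs_summable_summable[OF this] show ?thesis by (simp add: g_def)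
qed

text \<open>Summing over k first, the row n is a positive multiple of the full Gaussian sum for even
  n and of the alternating one for odd n. So no row is negative, and the row n = 0 is at least
  1.\<close>

lemma twisted_theta_pos: "twisted_theta > 0"
proof -
  define g :: "int \<Rightarrow> real" where "g k = exp (- pi * (of_int k)\<^sup>2 / 2)" for k
  define S where "S n = (\<Sum>\<^sub>\<infinity>k::int. (-1) powi (n * k) * g k)" for n
  have smb: "(\<lambda>(n, k). (-1) powi (n * k) * (g n * g k)) summable_on UNIV \<times> UNIV"
    using twisted_theta_summable by (simp add: g_def)
  have "twisted_theta = (\<Sum>\<^sub>\<infinity>n. \<Sum>\<^sub>\<infinity>k. (-1) powi (n * k) * (g n * g k))"
    unfolding twisted_theta_def using infsum_Sigma'_banach[OF smb] by (simp add: g_def)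
  also have "\<dots> = (\<Sum>\<^sub>\<infinity>n. g n * S n)"
    by (simp add: S_def mult.left_commute infsum_cmult_right')
  finally have eq: "twisted_theta = (\<Sum>\<^sub>\<infinity>n. g n * S n)" .
  have gs: "g summable_on UNIV" using gaussian_summable_int by (simp add: g_def[abs_def])
  have g0: "g 0 = 1" by (simp add: g_def)
  have S0: "1 \<le> infsum g UNIV"
    using finite_sum_le_infsum[OF gs, of "{0}"] by (simp add: g_def)
  have S: "S n \<ge> 0" for n
  proof (cases "even n")
    case True
    thus ?thesis using S0 by (simp add: S_def minus_one_powi)
  next
    case False
    hence "S n = (\<Sum>\<^sub>\<infinity>k. (-1) powi k * g k)"
      by (simp add: S_def minus_one_powi)
    thus ?thesis using alternating_gaussian_nonneg by (simp add: g_def)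
  qed
  have "(\<lambda>n. \<Sum>\<^sub>\<infinity>k. (-1) powi (n * k) * (g n * g k)) summable_on UNIV"
    using summable_on_Sigma_banach[OF smb] by simp
  hence "(\<lambda>n. g n * S n) summable_on UNIV"
    by (simp add: S_def mult.left_commute infsum_cmult_right')
  hence "(\<Sum>n\<in>{0}. g n * S n) \<le> twisted_theta"
    unfolding eq using S by (intro finite_sum_le_infsum) (auto simp: g_def)
  moreover have "S 0 = infsum g UNIV" by (simp add: S_def)
  ultimately show ?thesis using S0 g0 by simp
qed

section \<open>Cut-offs of the sharp functional\<close>

lemma sharp_sign_mult_overlap_summable:
  assumes "l \<in> Lattice \<union> sharp_Lattice"
  shows "(\<lambda>v. sharp_sign v * overlap l v) summable_on sharp_Lattice"
proof (rule abs_summable_summable)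
  show "(\<lambda>v. norm (sharp_sign v * overlap l v)) summable_on sharp_Lattice"
    using gaussian_shift_summable[OF assms, of 0] by (simp add: norm_sharp_sign_mult_overlap)
qed

text \<open>Reflection in l permutes the sharp points and reverses the sign of each term, so the sum
  equals its negative. In this form the sharp functional kills Gabor functions at lattice
  points.\<close>

lemma infsum_sharp_sign_mult_overlap_Lattice:
  assumes "l \<in> Lattice"
  shows "(\<Sum>\<^sub>\<infinity>v\<in>sharp_Lattice. sharp_sign v * overlap l v) = 0"
proof -
  let ?S = "\<Sum>\<^sub>\<infinity>v\<in>sharp_Lattice. sharp_sign v * overlap l v"
  have "?S = (\<Sum>\<^sub>\<infinity>v\<in>sharp_Lattice. - (sharp_sign v * overlap l v))"
    by (rule infsum_reindex_bij_witness[where i = "\<lambda>v. l + l - v" and j = "\<lambda>v. l + l - v"])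
       (use assms in \<open>auto simp: sharp_Lattice_reflect sharp_sign_mult_overlap_reflect\<close>)
  also have "\<dots> = - ?S" by (rule infsum_uminus)
  finally show ?thesis by simp
qed

lemma infsum_sharp_sign_mult_overlap_sharp:
  assumes "l \<in> sharp_Lattice"
  shows "(\<Sum>\<^sub>\<infinity>v\<in>sharp_Lattice. sharp_sign v * overlap l v) = sharp_sign l * of_real twisted_theta"
proof -
  define f :: "int \<times> int \<Rightarrow> real" where "f = (\<lambda>(n, k). (-1) powi (n * k) *
     (exp (- pi * (of_int n)\<^sup>2 / 2) * exp (- pi * (of_int k)\<^sup>2 / 2)))"
  define e :: "int \<times> int \<Rightarrow> real \<times> real" where "e = (\<lambda>(n, k). l + (of_int n, of_int k))"
  have "range e = sharp_Lattice"
  proof (intro equalityI subsetI)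
    fix v assume "v \<in> range e"
    thus "v \<in> sharp_Lattice"
      using assms by (auto simp: e_def Lattice_def intro!: sharp_Lattice_add)
  next
    fix v assume "v \<in> sharp_Lattice"
    from sharp_Lattice_diff[OF this assms] obtain n k where "v - l = (of_int n, of_int k)"
      by (rule LatticeE)
    hence "v = e (n, k)" by (simp add: e_def algebra_simps)
    thus "v \<in> range e" by simp
  qed
  hence "(\<Sum>\<^sub>\<infinity>v\<in>sharp_Lattice. sharp_sign v * overlap l v) = (\<Sum>\<^sub>\<infinity>v\<in>range e. sharp_sign v * overlap l v)" by simp
  also have "\<dots> = (\<Sum>\<^sub>\<infinity>x. sharp_sign (e x) * overlap l (e x))"
    by (subst infsum_reindex) (auto simp: e_def inj_on_def o_def)
  also have "\<dots> = (\<Sum>\<^sub>\<infinity>x. sharp_sign l * of_real (f x))"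
    by (rule infsum_cong) (auto simp: e_def f_def sharp_sign_mult_overlap_translate[OF assms] split: prod.splits)
  also have "\<dots> = sharp_sign l * (\<Sum>\<^sub>\<infinity>x. of_real (f x))"
    by (rule infsum_cmult_right')
  also have "(\<Sum>\<^sub>\<infinity>x. of_real (f x) :: complex) = of_real (infsum f UNIV)"
    using has_sum_of_real[OF has_sum_infsum, of f UNIV] twisted_theta_summable
    by (intro infsumI) (simp add: f_def)
  also have "infsum f UNIV = twisted_theta" by (simp add: f_def twisted_theta_def)
  finally show ?thesis .
qed

section \<open>Tent functions and truncated sums\<close>

definition tent :: "real \<Rightarrow> real \<times> real \<Rightarrow> real" where
  "tent R v = max 0 (1 - norm v / R)"

lemma tent_eq_0: "R > 0 \<Longrightarrow> norm v \<ge> R \<Longrightarrow> tent R v = 0"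
  by (simp add: tent_def)

lemma tent_lipschitz:
  assumes "R > 0"
  shows "\<bar>tent R v - tent R w\<bar> \<le> norm (v - w) / R"
proof -
  have "\<bar>tent R v - tent R w\<bar> \<le> \<bar>norm v / R - norm w / R\<bar>"
    by (auto simp: tent_def)
  also have "\<dots> = \<bar>norm v - norm w\<bar> / R"
    using assms by (simp flip: diff_divide_distrib)
  also have "\<dots> \<le> norm (v - w) / R"
    using assms norm_triangle_ineq3[of v w] by (intro divide_right_mono) auto
  finally show ?thesis .
qed

text \<open>For |l| \<le> 2R the slope 1/R already has the right size, since R^2 + |l|^2 \<le> 5
  R^2. For larger l either v is so near to l that both tents vanish, or |v - l| \<ge> |l|/2 and the
  polynomial factor in |v - l| pays. A Gaussian in v - l absorbs that factor later.\<close>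

lemma tent_diff_le:
  assumes R: "R \<ge> 1"
  shows "\<bar>tent R v - tent R l\<bar> \<le> 5 * (norm (v - l) * (1 + 4 * (norm (v - l))\<^sup>2)) * (R / (R\<^sup>2 + (norm l)\<^sup>2))"
proof -
  define b x where "b = norm (v - l)" and "x = norm l"
  have b: "b \<ge> 0" and x: "x \<ge> 0" by (auto simp: b_def x_def)
  have pos: "R\<^sup>2 + x\<^sup>2 > 0" using R by (intro add_pos_nonneg) auto
  have K: "1 / R \<le> K * (R / P)" if "P \<le> K * R\<^sup>2" "P > 0" for K P
    using that R by (simp add: field_simps power2_eq_square)
  have lip: "\<bar>tent R v - tent R l\<bar> \<le> b / R"
    using tent_lipschitz[of R v l] R by (simp add: b_def)
  have "\<bar>tent R v - tent R l\<bar> \<le> 5 * (b * (1 + 4 * b\<^sup>2)) * (R / (R\<^sup>2 + x\<^sup>2))"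
  proof (cases "x \<le> 2 * R")
    case True
    hence "x\<^sup>2 \<le> (2 * R)\<^sup>2" using x by (intro power_mono) auto
    hence "R\<^sup>2 + x\<^sup>2 \<le> 5 * R * R" by (simp add: power2_eq_square)
    hence "1 / R \<le> 5 * (R / (R\<^sup>2 + x\<^sup>2))"
      using R pos by (simp add: field_simps power2_eq_square)
    hence "b * (1 / R) \<le> b * (5 * (R / (R\<^sup>2 + x\<^sup>2)))" using b by (rule mult_left_mono)
    also have "\<dots> \<le> (b * (1 + 4 * b\<^sup>2)) * (5 * (R / (R\<^sup>2 + x\<^sup>2)))"
      using b R pos by (intro mult_right_mono) (auto simp: distrib_left)
    finally show ?thesis using lip by (simp add: mult_ac)
  next
    case False
    show ?thesis
    proof (cases "b < x / 2")
      case True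
      have "x \<le> norm v + b"
        using norm_triangle_ineq2[of l v] by (simp add: b_def x_def norm_minus_commute)
      hence "tent R v = 0" "tent R l = 0"
        using True False R by (auto simp: x_def intro!: tent_eq_0)
      thus ?thesis using b R pos by simp
    next
      case bx: False
      hence "(x / 2)\<^sup>2 \<le> b\<^sup>2" using x by (intro power_mono) auto
      hence xb: "x\<^sup>2 \<le> 4 * b\<^sup>2" by (simp add: power_divide)
      have "R\<^sup>2 \<le> x\<^sup>2" using False R by (intro power_mono) auto
      hence "R\<^sup>2 + x\<^sup>2 \<le> 5 * x\<^sup>2" using zero_le_power2[of x] by linarith
      also have "\<dots> \<le> 5 * (4 * b\<^sup>2)" using xb by simp
      also have "5 * (4 * b\<^sup>2) \<le> 5 * (1 + 4 * b\<^sup>2) * 1" by simp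
      also have "\<dots> \<le> 5 * (1 + 4 * b\<^sup>2) * R\<^sup>2"
        using R by (intro mult_left_mono one_le_power) auto
      finally have "1 / R \<le> 5 * (1 + 4 * b\<^sup>2) * (R / (R\<^sup>2 + x\<^sup>2))"
        using R pos by (intro K) auto
      hence "b * (1 / R) \<le> b * (5 * (1 + 4 * b\<^sup>2) * (R / (R\<^sup>2 + x\<^sup>2)))" using b by (rule mult_left_mono)
      thus ?thesis using lip by (simp add: mult_ac)
    qed
  qed
  thus ?thesis by (simp add: b_def x_def)
qed

text \<open>The pairing of \<open>gabor l\<close> with a finite combination of Gabor functions at
  sharp points, a truncation of the sharp functional. Being finite, it may be applied to a relation
  term by term.\<close>

definition cutoff_sum :: "real \<Rightarrow> real \<times> real \<Rightarrow> complex" where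
  "cutoff_sum R l = (\<Sum>v\<in>{v \<in> sharp_Lattice. norm v < R}. sharp_sign v * of_real (tent R v) * overlap l v)"

lemma finite_sharp_ball: "finite {v \<in> sharp_Lattice. norm v < R}"
  by (rule finite_subset[OF _ finite_lattice_ball[of R]]) auto

lemma cutoff_sum_eq_infsum:
  assumes "R > 0"
  shows "cutoff_sum R l = (\<Sum>\<^sub>\<infinity>v\<in>sharp_Lattice. sharp_sign v * overlap l v * of_real (tent R v))"
proof -
  have "cutoff_sum R l = (\<Sum>\<^sub>\<infinity>v\<in>{v \<in> sharp_Lattice. norm v < R}. sharp_sign v * overlap l v * of_real (tent R v))"
    using finite_sharp_ball by (simp add: cutoff_sum_def mult_ac)
  also have "\<dots> = (\<Sum>\<^sub>\<infinity>v\<in>sharp_Lattice. sharp_sign v * overlap l v * of_real (tent R v))"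
    by (rule infsum_cong_neutral) (auto simp: tent_eq_0[OF assms])
  finally show ?thesis .
qed

text \<open>Subtracting t times the full sum replaces the tent by its deviation from t, and the
  other factors have Gaussian modulus. It is used with t = \<open>tent R l\<close> at lattice points
  and t = 1 at sharp points.\<close>

lemma cutoff_sum_minus:
  assumes "R > 0" "l \<in> Lattice \<union> sharp_Lattice"
    and bd: "\<And>v. v \<in> sharp_Lattice \<Longrightarrow> \<bar>tent R v - t\<bar> \<le> B v"
    and smb: "(\<lambda>v. exp (- pi * (norm (l - v))\<^sup>2 / 2) * B v) summable_on sharp_Lattice"
  shows "norm (cutoff_sum R l - of_real t * (\<Sum>\<^sub>\<infinity>v\<in>sharp_Lattice. sharp_sign v * overlap l v))
    \<le> (\<Sum>\<^sub>\<infinity>v\<in>sharp_Lattice. exp (- pi * (norm (l - v))\<^sup>2 / 2) * B v)"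
proof -
  have s: "(\<lambda>v. sharp_sign v * overlap l v * of_real (tent R v)) summable_on sharp_Lattice"
    by (rule summable_on_cong_neutral[THEN iffD1, OF _ _ _ summable_on_finite[OF finite_sharp_ball[of R]]])
       (auto simp: tent_eq_0[OF assms(1)])
  have s': "(\<lambda>v. of_real t * (sharp_sign v * overlap l v)) summable_on sharp_Lattice"
    by (intro summable_on_cmult_right sharp_sign_mult_overlap_summable assms)
  have "cutoff_sum R l - of_real t * (\<Sum>\<^sub>\<infinity>v\<in>sharp_Lattice. sharp_sign v * overlap l v)
    = (\<Sum>\<^sub>\<infinity>v\<in>sharp_Lattice. sharp_sign v * overlap l v * of_real (tent R v))
      + (\<Sum>\<^sub>\<infinity>v\<in>sharp_Lattice. - (of_real t * (sharp_sign v * overlap l v)))"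
    by (simp add: cutoff_sum_eq_infsum[OF assms(1)] infsum_uminus infsum_cmult_right')
  also have "\<dots> = (\<Sum>\<^sub>\<infinity>v\<in>sharp_Lattice. sharp_sign v * overlap l v * of_real (tent R v - t))"
    using s summable_on_uminus[THEN iffD2, OF s'] by (subst infsum_add[symmetric]) (auto simp: algebra_simps)
  finally have eq: "cutoff_sum R l - of_real t * (\<Sum>\<^sub>\<infinity>v\<in>sharp_Lattice. sharp_sign v * overlap l v)
    = (\<Sum>\<^sub>\<infinity>v\<in>sharp_Lattice. sharp_sign v * overlap l v * of_real (tent R v - t))" .
  have nm: "norm (sharp_sign v * overlap l v * of_real (tent R v - t)) \<le> exp (- pi * (norm (l - v))\<^sup>2 / 2) * B v"
    if "v \<in> sharp_Lattice" for v
    using bd[OF that] unfolding norm_mult[of "sharp_sign v * overlap l v"] norm_sharp_sign_mult_overlap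
    by (intro mult_left_mono) (auto simp del: of_real_diff)
  have "(\<lambda>v. sharp_sign v * overlap l v * of_real (tent R v - t)) summable_on sharp_Lattice"
    by (rule abs_summable_summable, rule summable_on_comparison_test[OF smb nm]) auto
  thus ?thesis unfolding eq
    by (rule norm_infsum_le[OF has_sum_infsum has_sum_infsum[OF smb] nm])
qed

text \<open>For t = \<open>tent R l\<close> the full sum is 0, so only increments of the tent count,
  and these carry the factor R / (R^2 + |l|^2). The remaining sum over v - l runs over the whole
  sharp coset, so \<open>B\<close> depends neither on l nor on R.\<close>

lemma cutoff_sum_Lattice_bound:
  obtains B where "B \<ge> 0"
    and "\<And>R l. R \<ge> 1 \<Longrightarrow> l \<in> Lattice \<Longrightarrow> norm (cutoff_sum R l) \<le> B * (R / (R\<^sup>2 + (norm l)\<^sup>2))"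
proof
  define g where "g b = exp (- pi * (norm b)\<^sup>2 / 2) * (5 * (norm b * (1 + 4 * (norm b)\<^sup>2)))" for b :: "real \<times> real"
  define B where "B = infsum g sharp_Lattice"
  have g0: "g b \<ge> 0" for b by (simp add: g_def)
  show "B \<ge> 0" unfolding B_def by (intro infsum_nonneg g0)
  have le: "g b \<le> 40 * (exp (- pi * (norm b)\<^sup>2 / 2) * exp (2 * norm b))" for b
  proof -
    have 1: "norm b \<le> exp (norm b)" using exp_ge_add_one_self[of "norm b"] by linarith
    have 2: "1 + 4 * (norm b)\<^sup>2 \<le> 8 * exp (norm b)"
      using exp_lower_Taylor_quadratic[of "norm b"] norm_ge_zero[of b] by linarith
    have "5 * (norm b * (1 + 4 * (norm b)\<^sup>2)) \<le> 5 * (exp (norm b) * (8 * exp (norm b)))"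
      using 1 2 by (intro mult_left_mono mult_mono) auto
    also have "\<dots> = 40 * exp (2 * norm b)" by (simp add: mult_exp_exp)
    finally have "g b \<le> exp (- pi * (norm b)\<^sup>2 / 2) * (40 * exp (2 * norm b))"
      unfolding g_def by (intro mult_left_mono) auto
    thus ?thesis by (simp only: mult_ac)
  qed
  have "(\<lambda>b. 40 * (exp (- pi * (norm b)\<^sup>2 / 2) * exp (2 * norm b))) summable_on sharp_Lattice"
    by (intro summable_on_cmult_right gaussian_summable) auto
  hence gs: "g summable_on sharp_Lattice"
    by (rule summable_on_comparison_test[OF _ le g0])
  fix R :: real and l assume R: "R \<ge> 1" and l: "l \<in> Lattice"
  let ?w = "R / (R\<^sup>2 + (norm l)\<^sup>2)"
  have img: "(\<lambda>v. v - l) ` sharp_Lattice = sharp_Lattice"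
  proof (intro equalityI subsetI)
    fix v assume "v \<in> sharp_Lattice"
    thus "v \<in> (\<lambda>v. v - l) ` sharp_Lattice"
      using l by (intro image_eqI[of _ _ "v + l"] sharp_Lattice_add) auto
  qed (use l sharp_Lattice_diff_Lattice in blast)
  have inj: "inj_on (\<lambda>v. v - l) sharp_Lattice" by (auto simp: inj_on_def)
  have gshift: "(\<lambda>v. g (v - l)) summable_on sharp_Lattice"
    using gs summable_on_reindex[OF inj, of g] unfolding img by (simp add: o_def)
  have gsum: "(\<Sum>\<^sub>\<infinity>v\<in>sharp_Lattice. g (v - l)) = B"
    using infsum_reindex[OF inj, of g] unfolding img B_def by (simp add: o_def)
  let ?B = "\<lambda>v. 5 * (norm (v - l) * (1 + 4 * (norm (v - l))\<^sup>2)) * ?w"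
  have eq: "exp (- pi * (norm (l - v))\<^sup>2 / 2) * ?B v = g (v - l) * ?w" for v
    by (simp add: g_def norm_minus_commute)
  have "norm (cutoff_sum R l - of_real (tent R l) * (\<Sum>\<^sub>\<infinity>v\<in>sharp_Lattice. sharp_sign v * overlap l v))
    \<le> (\<Sum>\<^sub>\<infinity>v\<in>sharp_Lattice. exp (- pi * (norm (l - v))\<^sup>2 / 2) * ?B v)"
  proof (rule cutoff_sum_minus)
    show "(\<lambda>v. exp (- pi * (norm (l - v))\<^sup>2 / 2) * ?B v) summable_on sharp_Lattice"
      unfolding eq by (intro summable_on_cmult_left gshift)
  qed (use R l tent_diff_le[OF R] in auto)
  also have "\<dots> = B * ?w"
    unfolding eq infsum_cmult_left' gsum ..
  finally show "norm (cutoff_sum R l) \<le> B * ?w"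
    by (simp add: infsum_sharp_sign_mult_overlap_Lattice[OF l])
qed

text \<open>The tent differs from 1 by at most |v| / R, and |v| times the Gaussian around l is
  summable, so the error is O(1/R).\<close>

lemma cutoff_sum_sharp_tendsto:
  assumes l: "l \<in> sharp_Lattice"
  shows "(\<lambda>n. cutoff_sum (real (Suc n)) l) \<longlonglongrightarrow> sharp_sign l * of_real twisted_theta"
proof -
  define g where "g v = exp (- pi * (norm (l - v))\<^sup>2 / 2) * norm v" for v
  define D where "D = infsum g sharp_Lattice"
  have le: "g v \<le> (norm l + 1) * (exp (- pi * (norm (l - v))\<^sup>2 / 2) * exp (1 * norm (l - v)))" for v
  proof -
    have "norm v \<le> norm l + norm (l - v)"
      by (metis add.commute norm_minus_commute norm_triangle_sub)
    also have "\<dots> \<le> (norm l + 1) * (1 + norm (l - v))"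
      by (simp add: distrib_left distrib_right)
    also have "\<dots> \<le> (norm l + 1) * exp (norm (l - v))"
      using exp_ge_add_one_self[of "norm (l - v)"] by (intro mult_left_mono) auto
    finally have "g v \<le> exp (- pi * (norm (l - v))\<^sup>2 / 2) * ((norm l + 1) * exp (norm (l - v)))"
      unfolding g_def by (intro mult_left_mono) auto
    thus ?thesis by (simp only: mult_ac mult_1_left mult_1_right)
  qed
  have "(\<lambda>v. (norm l + 1) * (exp (- pi * (norm (l - v))\<^sup>2 / 2) * exp (1 * norm (l - v)))) summable_on sharp_Lattice"
    using l by (intro summable_on_cmult_right gaussian_shift_summable) auto
  hence gs: "g summable_on sharp_Lattice"
    by (rule summable_on_comparison_test) (use le in \<open>auto simp: g_def\<close>)
  have bound: "norm (cutoff_sum (real (Suc n)) l - sharp_sign l * of_real twisted_theta) \<le> D / real (Suc n)" for n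
  proof -
    let ?R = "real (Suc n)"
    have eq: "exp (- pi * (norm (l - v))\<^sup>2 / 2) * (norm v / ?R) = g v * (1 / ?R)" for v
      by (simp add: g_def)
    have "norm (cutoff_sum ?R l - of_real 1 * (\<Sum>\<^sub>\<infinity>v\<in>sharp_Lattice. sharp_sign v * overlap l v))
      \<le> (\<Sum>\<^sub>\<infinity>v\<in>sharp_Lattice. exp (- pi * (norm (l - v))\<^sup>2 / 2) * (norm v / ?R))"
    proof (rule cutoff_sum_minus)
      show "(\<lambda>v. exp (- pi * (norm (l - v))\<^sup>2 / 2) * (norm v / ?R)) summable_on sharp_Lattice"
        unfolding eq by (intro summable_on_cmult_left gs)
      show "\<bar>tent ?R v - 1\<bar> \<le> norm v / ?R" for v
        using tent_lipschitz[of ?R v 0] by (simp add: tent_def)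
    qed (use l in auto)
    also have "\<dots> = D * (1 / ?R)"
      unfolding eq infsum_cmult_left' D_def ..
    finally show ?thesis by (simp add: infsum_sharp_sign_mult_overlap_sharp[OF l])
  qed
  have "(\<lambda>n. D / real (Suc n)) \<longlonglongrightarrow> 0"
    by (rule LIMSEQ_Suc[OF lim_const_over_n])
  hence "(\<lambda>n. cutoff_sum (real (Suc n)) l - sharp_sign l * of_real twisted_theta) \<longlonglongrightarrow> 0"
    by (rule Lim_null_comparison[OF always_eventually, rotated]) (use bound in auto)
  thus ?thesis by (simp add: LIM_zero_iff)
qed

text \<open>A bounded sequence in l2 that tends to 0 pointwise tends to 0 weakly; the bound is
  expressed by majorants \<open>u n\<close> of the squares. A finite set carries most of
  \<open>c\<close>, and off it a weighted mean inequality separates \<open>c\<close> from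
  \<open>t n\<close>.\<close>

lemma bounded_pointwise_null_imp_weak_null:
  fixes c :: "'a \<Rightarrow> complex" and t :: "nat \<Rightarrow> 'a \<Rightarrow> complex"
  assumes c: "(\<lambda>l. (norm (c l))\<^sup>2) summable_on A"
    and u: "\<And>n. u n summable_on A" "\<And>n. infsum (u n) A \<le> K"
    and tu: "\<And>n l. l \<in> A \<Longrightarrow> (norm (t n l))\<^sup>2 \<le> u n l"
    and lim: "\<And>l. l \<in> A \<Longrightarrow> (\<lambda>n. t n l) \<longlonglongrightarrow> 0"
    and smb: "\<And>n. (\<lambda>l. c l * t n l) summable_on A"
  shows "(\<lambda>n. \<Sum>\<^sub>\<infinity>l\<in>A. c l * t n l) \<longlonglongrightarrow> 0"
proof (rule tendstoI)
  fix e :: real assume e: "e > 0"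
  let ?n2 = "\<lambda>l. (norm (c l))\<^sup>2"
  have u0: "u n l \<ge> 0" if "l \<in> A" for n l using tu[OF that, of n] by (meson order_trans zero_le_power2)
  have K: "K \<ge> 0" using u(2)[of 0] infsum_nonneg[of A "u 0"] u0 by force
  \<comment> \<open>With this weight the finite part gives less than e/4, the tail of
    \<open>c\<close> at most e/8 and the bound K at most e/2.\<close>
  define d where "d = e / (K + 1)"
  have d: "d > 0" using e K by (simp add: d_def)
  obtain F where F: "finite F" "F \<subseteq> A" "dist (sum ?n2 F) (infsum ?n2 A) \<le> d * e / 4"
    using infsum_finite_approximation[OF c, of "d * e / 4"] d e by auto
  have tail: "infsum ?n2 (A - F) \<le> d * e / 4"
  proof -
    have "infsum ?n2 A = infsum ?n2 F + infsum ?n2 (A - F)"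
      using F by (subst infsum_Un_disjoint[symmetric])
        (auto intro: summable_on_subset[OF c] simp: Un_absorb1)
    thus ?thesis using F by (simp add: dist_real_def)
  qed
  have "(\<lambda>n. \<Sum>l\<in>F. c l * t n l) \<longlonglongrightarrow> (\<Sum>l\<in>F. c l * 0)"
    using F lim by (intro tendsto_sum tendsto_mult tendsto_const) auto
  hence "(\<lambda>n. \<Sum>l\<in>F. c l * t n l) \<longlonglongrightarrow> 0" by simp
  hence "\<forall>\<^sub>F n in sequentially. dist (\<Sum>l\<in>F. c l * t n l) 0 < e / 4"
    using e by (intro tendstoD) auto
  thus "\<forall>\<^sub>F n in sequentially. dist (\<Sum>\<^sub>\<infinity>l\<in>A. c l * t n l) 0 < e"
  proof eventually_elim
    case (elim n)
    have sA: "(\<lambda>l. c l * t n l) summable_on (A - F)"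
      by (rule summable_on_subset[OF smb]) auto
    have "(\<Sum>\<^sub>\<infinity>l\<in>A. c l * t n l) = (\<Sum>l\<in>F. c l * t n l) + (\<Sum>\<^sub>\<infinity>l\<in>A - F. c l * t n l)"
      using F sA by (subst infsum_finite[OF F(1), symmetric], subst infsum_Un_disjoint[symmetric])
        (auto simp: Un_absorb1)
    hence "norm (\<Sum>\<^sub>\<infinity>l\<in>A. c l * t n l) \<le> norm (\<Sum>l\<in>F. c l * t n l) + norm (\<Sum>\<^sub>\<infinity>l\<in>A - F. c l * t n l)"
      by (simp add: norm_triangle_ineq)
    also have "norm (\<Sum>\<^sub>\<infinity>l\<in>A - F. c l * t n l) \<le> (\<Sum>\<^sub>\<infinity>l\<in>A - F. ?n2 l * (1 / (2 * d)) + u n l * (d / 2))"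
    proof (rule norm_infsum_le[OF has_sum_infsum[OF sA] has_sum_infsum])
      show "(\<lambda>l. ?n2 l * (1 / (2 * d)) + u n l * (d / 2)) summable_on (A - F)"
        by (intro summable_on_add summable_on_cmult_left summable_on_subset[OF c] summable_on_subset[OF u(1)]) auto
      fix l assume l: "l \<in> A - F"
      have "0 \<le> (norm (c l) - d * norm (t n l))\<^sup>2 / (2 * d)" using d by simp
      also have "\<dots> = ?n2 l * (1 / (2 * d)) + (norm (t n l))\<^sup>2 * (d / 2) - norm (c l) * norm (t n l)"
        using d by (simp add: power2_eq_square field_simps)
      finally have "norm (c l * t n l) \<le> ?n2 l * (1 / (2 * d)) + (norm (t n l))\<^sup>2 * (d / 2)"
        by (simp add: norm_mult)
      also have "\<dots> \<le> ?n2 l * (1 / (2 * d)) + u n l * (d / 2)"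
        using tu[of l n] l d by (intro add_left_mono mult_right_mono) auto
      finally show "norm (c l * t n l) \<le> ?n2 l * (1 / (2 * d)) + u n l * (d / 2)" .
    qed
    also have "\<dots> = infsum ?n2 (A - F) * (1 / (2 * d)) + infsum (u n) (A - F) * (d / 2)"
      by (subst infsum_add, intro summable_on_cmult_left summable_on_subset[OF c] Diff_subset,
          intro summable_on_cmult_left summable_on_subset[OF u(1)] Diff_subset) (simp only: infsum_cmult_left')
    also have "\<dots> \<le> (d * e / 4) * (1 / (2 * d)) + K * (d / 2)"
    proof (intro add_mono mult_right_mono tail)
      have "infsum (u n) (A - F) \<le> infsum (u n) A"
        using u0 by (intro infsum_mono2 u summable_on_subset[OF u(1)]) auto
      thus "infsum (u n) (A - F) \<le> K" using u(2)[of n] by simp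
    qed (use d in auto)
    also have "(d * e / 4) * (1 / (2 * d)) = e / 8" using d by simp
    also have "K * (d / 2) \<le> e / 2" using e K by (simp add: d_def field_simps)
    finally show ?case using elim e by simp
  qed
qed

text \<open>The functional \<open>e\<^sub>\<mu> \<mapsto> sharp_sign \<mu>\<close> kills every \<open>e\<^sub>\<lambda>\<close>, but is not continuous
  on \<open>L\<^sub>2\<close>. Its cut-offs are bounded on \<open>l\<^sub>2(\<Lambda>)\<close>, because a tent of radius \<open>R\<close> in
  the plane has Dirichlet energy of order one, and so tend to 0 weakly there.\<close>

lemma sum_sharp_sign_eq_0:
  fixes c :: "real \<times> real \<Rightarrow> complex"
  assumes M: "finite M" "M \<subseteq> sharp_Lattice"
    and l2: "(\<lambda>l. (norm (c l))\<^sup>2) summable_on Lattice"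
    and rel: "\<And>v. v \<in> sharp_Lattice \<Longrightarrow> ((\<lambda>l. c l * overlap l v) has_sum 0) (Lattice \<union> M)"
  shows "(\<Sum>l\<in>M. c l * sharp_sign l) = 0"
proof -
  let ?t = "\<lambda>n. cutoff_sum (real (Suc n))"
  \<comment> \<open>A finite combination of the given relations, one for each sharp point in the
    ball.\<close>
  have hs: "((\<lambda>l. c l * ?t n l) has_sum 0) (Lattice \<union> M)" for n
  proof -
    let ?N = "{v \<in> sharp_Lattice. norm v < real (Suc n)}"
    have "((\<lambda>l. \<Sum>v\<in>?N. (sharp_sign v * of_real (tent (real (Suc n)) v)) * (c l * overlap l v)) has_sum
        (\<Sum>v\<in>?N. (sharp_sign v * of_real (tent (real (Suc n)) v)) * 0)) (Lattice \<union> M)"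
      by (intro has_sum_finite_sum finite_sharp_ball has_sum_cmult_right rel) auto
    thus ?thesis by (simp add: cutoff_sum_def sum_distrib_left mult_ac)
  qed
  have smb: "(\<lambda>l. c l * ?t n l) summable_on Lattice" for n
    by (rule summable_on_subset[OF has_sum_imp_summable[OF hs]]) auto
  have split: "(\<Sum>l\<in>M. c l * ?t n l) = - (\<Sum>\<^sub>\<infinity>l\<in>Lattice. c l * ?t n l)" for n
  proof -
    have "0 = (\<Sum>\<^sub>\<infinity>l\<in>Lattice. c l * ?t n l) + (\<Sum>\<^sub>\<infinity>l\<in>M. c l * ?t n l)"
      using infsumI[OF hs[of n]] smb[of n] M Lattice_sharp_disjoint
      by (subst infsum_Un_disjoint[symmetric]) auto
    thus ?thesis using M(1) by (simp add: eq_neg_iff_add_eq_0 add.commute)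
  qed
  obtain B where B: "B \<ge> 0" "\<And>R l. R \<ge> 1 \<Longrightarrow> l \<in> Lattice \<Longrightarrow> norm (cutoff_sum R l) \<le> B * (R / (R\<^sup>2 + (norm l)\<^sup>2))"
    by (rule cutoff_sum_Lattice_bound) blast
  have "(\<lambda>n. \<Sum>\<^sub>\<infinity>l\<in>Lattice. c l * ?t n l) \<longlonglongrightarrow> 0"
  proof (rule bounded_pointwise_null_imp_weak_null[OF l2, where u = "\<lambda>n l. B\<^sup>2 * lattice_weight (real (Suc n)) l" and K = "B\<^sup>2 * 36"])
    show "(\<lambda>l. B\<^sup>2 * lattice_weight (real (Suc n)) l) summable_on Lattice" for n
      by (intro summable_on_cmult_right lattice_weight_summable) auto
    show "(\<Sum>\<^sub>\<infinity>l\<in>Lattice. B\<^sup>2 * lattice_weight (real (Suc n)) l) \<le> B\<^sup>2 * 36" for n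
      using infsum_lattice_weight_le[of "real (Suc n)"] by (simp add: infsum_cmult_right' mult_left_mono del: of_nat_Suc)
    fix n l assume l: "l \<in> Lattice"
    let ?R = "real (Suc n)"
    let ?w = "?R / (?R\<^sup>2 + (norm l)\<^sup>2)"
    \<comment> \<open>Replacing |l|^2 by the square of one coordinate enlarges the fraction, so the
      squared radial bound lies below the product weight, whose mass is at most 36 for every
      radius.\<close>
    have le: "?w \<le> ?R / (?R\<^sup>2 + (fst l)\<^sup>2)" "?w \<le> ?R / (?R\<^sup>2 + (snd l)\<^sup>2)"
      by (intro divide_left_mono mult_pos_pos add_pos_nonneg; simp add: norm_power2_prod del: of_nat_Suc)+
    have "(norm (?t n l))\<^sup>2 \<le> (B * ?w)\<^sup>2"
      using B(2)[of ?R l] l by (intro power_mono) auto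
    also have "\<dots> = B\<^sup>2 * (?w * ?w)" by (simp only: power2_eq_square mult_ac)
    also have "\<dots> \<le> B\<^sup>2 * lattice_weight ?R l"
      unfolding lattice_weight_def using le by (intro mult_left_mono mult_mono) auto
    finally show "(norm (?t n l))\<^sup>2 \<le> B\<^sup>2 * lattice_weight ?R l" .
  next
    fix l assume l: "l \<in> Lattice"
    have "norm (?t n l) \<le> B / real (Suc n)" for n
    proof -
      let ?R = "real (Suc n)"
      have "?R / (?R\<^sup>2 + (norm l)\<^sup>2) \<le> ?R / ?R\<^sup>2"
        by (intro divide_left_mono mult_pos_pos add_pos_nonneg) (simp_all del: of_nat_Suc)
      also have "\<dots> = 1 / ?R" by (simp add: power2_eq_square)
      finally have "B * (?R / (?R\<^sup>2 + (norm l)\<^sup>2)) \<le> B * (1 / ?R)"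
        using B(1) by (rule mult_left_mono)
      thus ?thesis using B(2)[of ?R l] l by simp
    qed
    moreover have "(\<lambda>n. B / real (Suc n)) \<longlonglongrightarrow> 0"
      by (rule LIMSEQ_Suc[OF lim_const_over_n])
    ultimately show "(\<lambda>n. ?t n l) \<longlonglongrightarrow> 0"
      by (intro Lim_null_comparison[of "\<lambda>n. ?t n l" "\<lambda>n. B / real (Suc n)"] always_eventually) auto
  qed (rule smb)
  hence "(\<lambda>n. \<Sum>l\<in>M. c l * ?t n l) \<longlonglongrightarrow> 0"
    unfolding split using tendsto_minus by fastforce
  moreover have "(\<lambda>n. \<Sum>l\<in>M. c l * ?t n l) \<longlonglongrightarrow> (\<Sum>l\<in>M. c l * (sharp_sign l * of_real twisted_theta))"
    using M by (intro tendsto_sum tendsto_mult tendsto_const cutoff_sum_sharp_tendsto) auto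
  ultimately have "(\<Sum>l\<in>M. c l * (sharp_sign l * of_real twisted_theta)) = 0"
    using LIMSEQ_unique by blast
  hence "(\<Sum>l\<in>M. c l * sharp_sign l) * of_real twisted_theta = 0"
    by (simp only: sum_distrib_right mult.assoc)
  thus ?thesis using twisted_theta_pos by simp
qed

section \<open>Vanishing moments\<close>

text \<open>The Gaussian factor is kept outside \<open>c\<close>, so that square summability can be
  asked of the Gabor coefficients themselves.\<close>

definition moments_vanish :: "(real \<times> real) set \<Rightarrow> (real \<times> real \<Rightarrow> complex) \<Rightarrow> bool" where
  "moments_vanish L c \<longleftrightarrow> (\<forall>n. ((\<lambda>l. c l * fock_factor l * to_complex l ^ n) has_sum 0) L)"

lemma l2_Un_finite_bounded:
  fixes c :: "'a \<Rightarrow> complex"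
  assumes "(\<lambda>l. (norm (c l))\<^sup>2) summable_on A" "finite M"
  obtains K where "\<And>l. l \<in> A \<union> M \<Longrightarrow> norm (c l) \<le> K"
proof
  let ?S = "infsum (\<lambda>l. (norm (c l))\<^sup>2) A"
  fix l assume "l \<in> A \<union> M"
  thus "norm (c l) \<le> sqrt ?S + (\<Sum>l\<in>M. norm (c l))"
  proof
    assume "l \<in> A"
    hence "(norm (c l))\<^sup>2 \<le> ?S"
      using finite_sum_le_infsum[OF assms(1), of "{l}"] by simp
    hence "norm (c l) \<le> sqrt ?S" by (rule real_le_rsqrt)
    thus ?thesis by (intro add_increasing2 sum_nonneg) auto
  next
    assume "l \<in> M"
    hence "norm (c l) \<le> (\<Sum>l\<in>M. norm (c l))"
      using assms(2) by (intro member_le_sum) auto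
    moreover have "?S \<ge> 0" by (intro infsum_nonneg) auto
    ultimately show ?thesis by (intro add_increasing) auto
  qed
qed

lemma fock_factor_exp_summable:
  assumes "L \<subseteq> Lattice \<union> sharp_Lattice" "\<And>l. l \<in> L \<Longrightarrow> norm (c l) \<le> K" "r \<ge> 0"
  shows "(\<lambda>l. norm (c l * fock_factor l) * exp (r * norm (to_complex l))) summable_on L"
proof (rule summable_on_comparison_test)
  show "(\<lambda>l. K * (exp (- pi * (norm l)\<^sup>2 / 2) * exp (r * norm l))) summable_on L"
    by (intro summable_on_cmult_right gaussian_summable assms)
  fix l assume "l \<in> L"
  thus "norm (c l * fock_factor l) * exp (r * norm (to_complex l)) \<le> K * (exp (- pi * (norm l)\<^sup>2 / 2) * exp (r * norm l))"
    unfolding norm_mult norm_fock_factor norm_to_complex mult.assoc by (intro mult_right_mono assms) auto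
qed auto

text \<open>By \<open>overlap_factor\<close> the sum is, up to a nonzero factor, an entire function
  of w = pi cnj(v) whose Taylor coefficients are the moments divided by n!. As v runs over the
  plane, w takes every complex value, so this function is zero exactly when all moments are.\<close>

lemma moments_vanish_iff_overlap:
  assumes "L \<subseteq> Lattice \<union> sharp_Lattice" "\<And>l. l \<in> L \<Longrightarrow> norm (c l) \<le> K"
  shows "moments_vanish L c \<longleftrightarrow> (\<forall>v. ((\<lambda>l. c l * overlap l v) has_sum 0) L)"
proof -
  let ?a = "\<lambda>l. c l * fock_factor l"
  note ps = exp_sum_powser[of ?a to_complex L, OF fock_factor_exp_summable[of L c K, OF assms]]
  have ov: "c l * overlap l v = cnj (fock_factor v) * (?a l * exp (to_complex l * (of_real pi * cnj (to_complex v))))" for l v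
    by (simp add: overlap_factor mult_ac)
  show ?thesis
  proof
    assume "moments_vanish L c"
    hence "(\<Sum>\<^sub>\<infinity>l\<in>L. ?a l * to_complex l ^ n) = 0" for n
      by (auto simp: moments_vanish_def intro: infsumI)
    hence "(\<lambda>n. 0) sums (\<Sum>\<^sub>\<infinity>l\<in>L. ?a l * exp (to_complex l * w))" for w
      using ps(3)[of w] by simp
    hence "(\<Sum>\<^sub>\<infinity>l\<in>L. ?a l * exp (to_complex l * w)) = 0" for w
      using sums_unique2[OF _ sums_zero] by blast
    hence "((\<lambda>l. ?a l * exp (to_complex l * w)) has_sum 0) L" for w
      using has_sum_infsum[OF ps(2)[of w]] by simp
    from has_sum_cmult_right[OF this] show "\<forall>v. ((\<lambda>l. c l * overlap l v) has_sum 0) L"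
      unfolding ov by (metis mult_zero_right)
  next
    assume rel: "\<forall>v. ((\<lambda>l. c l * overlap l v) has_sum 0) L"
    have zero: "(\<Sum>\<^sub>\<infinity>l\<in>L. ?a l * exp (to_complex l * w)) = 0" for w
    proof -
      define v where "v = (Re (w / of_real pi), - Im (w / of_real pi))"
      have w: "of_real pi * cnj (to_complex v) = w"
        by (simp add: v_def to_complex_def complex_eq_iff)
      have "((\<lambda>l. cnj (fock_factor v) * (?a l * exp (to_complex l * w))) has_sum 0) L"
        using rel[rule_format, of v] unfolding ov w .
      from infsumI[OF this] show ?thesis
        by (simp add: infsum_cmult_right' fock_factor_nz)
    qed
    have "(\<Sum>\<^sub>\<infinity>l\<in>L. ?a l * to_complex l ^ n) / fact n = 0" for n
      by (rule powser_zero_imp_coeff_zero[where a = "\<lambda>n. (\<Sum>\<^sub>\<infinity>l\<in>L. ?a l * to_complex l ^ n) / fact n"])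
         (use ps(3) zero in simp)
    hence "(\<Sum>\<^sub>\<infinity>l\<in>L. ?a l * to_complex l ^ n) = 0" for n by simp
    thus "moments_vanish L c"
      using has_sum_infsum[OF ps(1)] by (simp add: moments_vanish_def)
  qed
qed

section \<open>Multiplication of relations by polynomials\<close>

lemma moments_vanish_mult_to_complex:
  assumes "moments_vanish L c"
  shows "moments_vanish L (\<lambda>l. c l * to_complex l ^ k)"
  using assms unfolding moments_vanish_def
proof (intro allI)
  fix n assume "\<forall>n. ((\<lambda>l. c l * fock_factor l * to_complex l ^ n) has_sum 0) L"
  from this[rule_format, of "k + n"] show "((\<lambda>l. c l * to_complex l ^ k * fock_factor l * to_complex l ^ n) has_sum 0) L"
    by (simp add: power_add mult_ac)
qed

lemma moments_vanish_mult_linear: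
  assumes "moments_vanish L c"
  shows "moments_vanish L (\<lambda>l. c l * (to_complex l - s))"
  unfolding moments_vanish_def
proof
  fix n
  have "((\<lambda>l. c l * fock_factor l * to_complex l ^ Suc n + (- s) * (c l * fock_factor l * to_complex l ^ n)) has_sum (0 + (- s) * 0)) L"
    by (intro has_sum_add has_sum_cmult_right assms[unfolded moments_vanish_def, rule_format])
  thus "((\<lambda>l. c l * (to_complex l - s) * fock_factor l * to_complex l ^ n) has_sum 0) L"
    by (simp add: algebra_simps)
qed

lemma moments_vanish_mult_prod:
  assumes "moments_vanish L c" "finite S"
  shows "moments_vanish L (\<lambda>l. c l * (\<Prod>s\<in>S. to_complex l - to_complex s))"
  using assms(2)
proof (induction S rule: finite_induct)
  case empty
  show ?case using assms(1) by simp
next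
  case (insert s S)
  from moments_vanish_mult_linear[OF insert.IH, of "to_complex s"] insert.hyps show ?case
    by (simp add: mult_ac)
qed

lemma moments_vanish_imp_sum_sharp_sign:
  assumes "finite M" "M \<subseteq> sharp_Lattice" "(\<lambda>l. (norm (c l))\<^sup>2) summable_on Lattice"
    and "moments_vanish (Lattice \<union> M) c"
  shows "(\<Sum>l\<in>M. c l * sharp_sign l) = 0"
proof -
  obtain K where K: "\<And>l. l \<in> Lattice \<union> M \<Longrightarrow> norm (c l) \<le> K"
    using l2_Un_finite_bounded[OF assms(3,1)] by blast
  have "Lattice \<union> M \<subseteq> Lattice \<union> sharp_Lattice" using assms(2) by auto
  from moments_vanish_iff_overlap[where c = c, OF this K] assms show ?thesis
    by (intro sum_sharp_sign_eq_0) auto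
qed

section \<open>Division of relations by a linear factor vanishing at the sharp point\<close>

lemma norm_to_complex_diff_sharp_ge:
  assumes "l \<in> Lattice"
  shows "norm (to_complex l - to_complex sharp) \<ge> 1 / 2"
proof -
  obtain a b where l: "l = (of_int a, of_int b)" using assms by (rule LatticeE)
  have "a \<ge> 1 \<or> a \<le> 0" by presburger
  hence "\<bar>of_int a - 1/2\<bar> \<ge> (1/2 :: real)" by linarith
  also have "\<bar>of_int a - 1/2\<bar> = \<bar>Re (to_complex l - to_complex sharp)\<bar>" by (simp add: l to_complex_def sharp_def)
  also have "\<dots> \<le> norm (to_complex l - to_complex sharp)" by (rule abs_Re_le_cmod)
  finally show ?thesis .
qed

lemma sharp_in_sharp_Lattice: "sharp \<in> sharp_Lattice"
  by (simp add: sharp_Lattice_iff Lattice_def zero_prod_def)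

text \<open>If all moments of \<open>c\<close> vanish, those of \<open>c / (z - w)\<close> are \<open>w\<^sup>n\<close> times the zeroth
  one: this is a linear relation with the single extra vector \<open>e\<^sub>w\<close>, so the zeroth moment is 0.\<close>

lemma moments_vanish_divide_sharp:
  assumes l2: "(\<lambda>l. (norm (c l))\<^sup>2) summable_on Lattice" and mv: "moments_vanish Lattice c"
  defines "c' \<equiv> \<lambda>l. c l / (to_complex l - to_complex sharp)"
  shows "(\<lambda>l. (norm (c' l))\<^sup>2) summable_on Lattice" and "moments_vanish Lattice c'"
proof -
  have nz: "to_complex l - to_complex sharp \<noteq> 0" if "l \<in> Lattice" for l
    using norm_to_complex_diff_sharp_ge[OF that] by auto
  have le: "norm (c' l) \<le> 2 * norm (c l)" if "l \<in> Lattice" for l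
  proof -
    have "norm (c' l) = norm (c l) / norm (to_complex l - to_complex sharp)" by (simp add: c'_def norm_divide)
    also have "\<dots> \<le> norm (c l) / (1/2)"
      using norm_to_complex_diff_sharp_ge[OF that] by (intro divide_left_mono) auto
    finally show ?thesis by simp
  qed
  show l2': "(\<lambda>l. (norm (c' l))\<^sup>2) summable_on Lattice"
  proof (rule summable_on_comparison_test)
    show "(\<lambda>l. 4 * (norm (c l))\<^sup>2) summable_on Lattice" by (intro summable_on_cmult_right l2)
    fix l assume "l \<in> Lattice"
    from power_mono[OF le[OF this], of 2] show "(norm (c' l))\<^sup>2 \<le> 4 * (norm (c l))\<^sup>2"
      by (simp add: power_mult_distrib)
  qed auto
  obtain K where K: "\<And>l. l \<in> Lattice \<union> {} \<Longrightarrow> norm (c' l) \<le> K"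
    using l2_Un_finite_bounded[OF l2' finite.emptyI] by blast
  define G where "G = (\<Sum>\<^sub>\<infinity>l\<in>Lattice. c' l * fock_factor l)"
  have mom: "((\<lambda>l. c' l * fock_factor l * to_complex l ^ n) has_sum (to_complex sharp ^ n * G)) Lattice" for n
  proof (induction n)
    case 0
    have "(\<lambda>l. c' l * fock_factor l * to_complex l ^ 0) summable_on Lattice"
      using K by (intro exp_sum_powser(1) fock_factor_exp_summable[where K = K]) auto
    thus ?case by (simp add: G_def)
  next
    case (Suc n)
    \<comment> \<open>Since z c' = c + w c' and the moments of \<open>c\<close> vanish, each moment
      of \<open>c'\<close> is w times the preceding one.\<close>
    have "((\<lambda>l. c l * fock_factor l * to_complex l ^ n + to_complex sharp * (c' l * fock_factor l * to_complex l ^ n)) has_sum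
        (0 + to_complex sharp * (to_complex sharp ^ n * G))) Lattice"
      using mv by (intro has_sum_add has_sum_cmult_right Suc) (auto simp: moments_vanish_def)
    moreover have "c l * fock_factor l * to_complex l ^ n + to_complex sharp * (c' l * fock_factor l * to_complex l ^ n) = c' l * fock_factor l * to_complex l ^ Suc n"
      if "l \<in> Lattice" for l
    proof -
      have eq: "c l = c' l * (to_complex l - to_complex sharp)" using nz[OF that] by (simp add: c'_def)
      show ?thesis unfolding eq by (simp add: algebra_simps)
    qed
    ultimately show ?case by (subst (asm) has_sum_cong) (auto simp: mult_ac)
  qed
  \<comment> \<open>The coefficient at w is chosen so that its moments -w^n G cancel those of
    \<open>c'\<close>; thus \<open>C\<close> is a relation on the lattice and one sharp
    point.\<close>
  define C where "C l = (if l = sharp then - G / fock_factor sharp else c' l)" for l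
  have ns: "sharp \<notin> Lattice" using Lattice_sharp_disjoint sharp_in_sharp_Lattice by auto
  have CL: "C l = c' l" if "l \<in> Lattice" for l using that ns by (auto simp: C_def)
  have "(\<Sum>l\<in>{sharp}. C l * sharp_sign l) = 0"
  proof (rule moments_vanish_imp_sum_sharp_sign)
    show "(\<lambda>l. (norm (C l))\<^sup>2) summable_on Lattice"
      using l2' by (rule summable_on_cong[THEN iffD1, rotated]) (simp add: CL)
    show "moments_vanish (Lattice \<union> {sharp}) C"
      unfolding moments_vanish_def
    proof
      fix n
      have 1: "((\<lambda>l. C l * fock_factor l * to_complex l ^ n) has_sum (to_complex sharp ^ n * G)) Lattice"
        using mom[of n] by (rule has_sum_cong[THEN iffD1, rotated]) (simp add: CL)
      have 2: "((\<lambda>l. C l * fock_factor l * to_complex l ^ n) has_sum (- (to_complex sharp ^ n * G))) {sharp}"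
        by (rule has_sum_finiteI) (auto simp: C_def fock_factor_nz)
      show "((\<lambda>l. C l * fock_factor l * to_complex l ^ n) has_sum 0) (Lattice \<union> {sharp})"
        using has_sum_Un_disjoint[OF 1 2] ns by simp
    qed
  qed (use sharp_in_sharp_Lattice in auto)
  hence "G = 0" by (simp add: C_def fock_factor_nz sharp_sign_def)
  thus "moments_vanish Lattice c'" using mom by (simp add: moments_vanish_def)
qed

text \<open>The factor \<open>q l ^ k\<close> is 1 at l0 and at most \<rho>^k at lattice points
  whose distance to the sharp point exceeds that of l0 by more than 1. The finitely many other
  points, some of them exactly as far as l0, are removed by a polynomial vanishing there. Letting k
  grow isolates l0.\<close>

lemma moments_vanish_imp_zero:
  assumes l2: "(\<lambda>l. (norm (c l))\<^sup>2) summable_on Lattice" and mv: "moments_vanish Lattice c"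
    and l0: "l0 \<in> Lattice"
  shows "c l0 = 0"
proof -
  let ?r = "\<lambda>l. to_complex l - to_complex sharp"
  have "(\<lambda>l. (norm (c l / ?r l ^ k))\<^sup>2) summable_on Lattice \<and> moments_vanish Lattice (\<lambda>l. c l / ?r l ^ k)" for k
  proof (induction k)
    case (Suc k)
    from moments_vanish_divide_sharp[OF conjunct1[OF Suc] conjunct2[OF Suc]]
    show ?case by (simp add: mult.commute)
  qed (use l2 mv in auto)
  hence mvk: "moments_vanish Lattice (\<lambda>l. c l / ?r l ^ k)" for k by blast
  define d where "d = norm (?r l0)"
  have d: "d > 0" using norm_to_complex_diff_sharp_ge[OF l0] unfolding d_def by linarith
  \<comment> \<open>The margin 1 yields the uniform ratio d / (d + 1) outside \<open>S\<close>; l0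
    is excluded so that the polynomial is nonzero there.\<close>
  define S where "S = {l \<in> Lattice. l \<noteq> l0 \<and> norm (?r l) \<le> d + 1}"
  have "S \<subseteq> {l \<in> Lattice \<union> sharp_Lattice. norm l \<le> d + 1 + norm (to_complex sharp)}"
  proof
    fix l assume "l \<in> S"
    moreover have "norm l \<le> norm (?r l) + norm (to_complex sharp)"
      unfolding norm_to_complex[symmetric, of l] using norm_triangle_ineq[of "?r l" "to_complex sharp"] by simp
    ultimately show "l \<in> {l \<in> Lattice \<union> sharp_Lattice. norm l \<le> d + 1 + norm (to_complex sharp)}"
      by (auto simp: S_def)
  qed
  hence fS: "finite S" using finite_lattice_ball finite_subset by blast
  define A where "A l = c l * (\<Prod>s\<in>S. to_complex l - to_complex s) * fock_factor l" for l
  define q where "q l = ?r l0 / ?r l" for l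
  define \<rho> where "\<rho> = d / (d + 1)"
  have \<rho>: "\<rho> \<ge> 0" "\<rho> < 1" using d by (auto simp: \<rho>_def)
  have Aq: "((\<lambda>l. A l * q l ^ k) has_sum 0) Lattice" for k
  proof -
    have "((\<lambda>l. c l / ?r l ^ k * (\<Prod>s\<in>S. to_complex l - to_complex s) * fock_factor l * to_complex l ^ 0) has_sum 0) Lattice"
      using moments_vanish_mult_prod[OF mvk fS, of k] unfolding moments_vanish_def by blast
    from has_sum_cmult_right[OF this, of "?r l0 ^ k"] show ?thesis
      by (simp add: A_def q_def power_divide mult_ac)
  qed
  have "A summable_on Lattice" using has_sum_imp_summable[OF Aq[of 0]] by simp
  hence Aabs: "(\<lambda>l. norm (A l)) summable_on Lattice"
    by (simp add: summable_on_iff_abs_summable_on_complex)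
  define T where "T = (\<Sum>\<^sub>\<infinity>l\<in>Lattice - {l0}. norm (A l))"
  have small: "norm (A l * q l ^ k) \<le> \<rho> ^ k * norm (A l)" if "l \<in> Lattice - {l0}" for l k
  proof (cases "l \<in> S")
    case True
    hence "A l = 0" using fS by (simp add: A_def prod_zero_iff) blast
    thus ?thesis by simp
  next
    case False
    hence "norm (?r l) > d + 1" using that by (auto simp: S_def)
    hence "norm (q l) \<le> \<rho>" using d unfolding q_def \<rho>_def norm_divide d_def[symmetric]
      by (intro divide_left_mono mult_pos_pos) linarith+
    hence "norm (q l) ^ k \<le> \<rho> ^ k" by (intro power_mono) auto
    from mult_right_mono[OF this norm_ge_zero, of "A l"] show ?thesis
      by (simp add: norm_mult norm_power mult.commute)
  qed
  have bound: "norm (A l0) \<le> \<rho> ^ k * T" for k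
  proof -
    have s: "(\<lambda>l. A l * q l ^ k) summable_on (Lattice - {l0})"
      by (rule summable_on_subset[OF has_sum_imp_summable[OF Aq]]) auto
    have "q l0 = 1" using d by (auto simp: q_def d_def)
    have "0 = (\<Sum>\<^sub>\<infinity>l\<in>insert l0 (Lattice - {l0}). A l * q l ^ k)"
      using infsumI[OF Aq[of k]] l0 by (simp add: insert_absorb)
    also have "\<dots> = A l0 + (\<Sum>\<^sub>\<infinity>l\<in>Lattice - {l0}. A l * q l ^ k)"
      using s \<open>q l0 = 1\<close> by (subst infsum_insert) auto
    finally have "norm (A l0) = norm (\<Sum>\<^sub>\<infinity>l\<in>Lattice - {l0}. A l * q l ^ k)"
      by (metis add_eq_0_iff norm_minus_cancel)
    also have "\<dots> \<le> (\<Sum>\<^sub>\<infinity>l\<in>Lattice - {l0}. \<rho> ^ k * norm (A l))"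
      by (rule norm_infsum_le[OF has_sum_infsum[OF s] has_sum_infsum small])
         (intro summable_on_cmult_right summable_on_subset[OF Aabs], auto)
    also have "\<dots> = \<rho> ^ k * T" unfolding T_def by (rule infsum_cmult_right')
    finally show ?thesis .
  qed
  have "(\<lambda>k. \<rho> ^ k * T) \<longlonglongrightarrow> 0 * T"
    using \<rho> by (intro tendsto_mult tendsto_const LIMSEQ_power_zero) auto
  hence "norm (A l0) \<le> 0"
    using bound by (intro LIMSEQ_le_const[of "\<lambda>k. \<rho> ^ k * T"]) auto
  hence "A l0 = 0" by simp
  moreover have "(\<Prod>s\<in>S. to_complex l0 - to_complex s) \<noteq> 0"
    using fS by (auto simp: S_def to_complex_def prod_eq_iff)
  ultimately show ?thesis by (simp add: A_def fock_factor_nz)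
qed

section \<open>From the relation in L2 to its coefficients\<close>

theorem proposition8p5:
  fixes m :: nat
    and \<mu> :: "nat \<Rightarrow> real \<times> real"
    and h :: "nat \<Rightarrow> nat \<Rightarrow> complex"
    and b :: "nat \<Rightarrow> complex"
    and c :: "real \<times> real \<Rightarrow> complex"
    and g :: "real \<Rightarrow> complex"
  assumes "\<mu> ` {..m} \<subseteq> sharp_Lattice"
    and "inj_on \<mu> {..m}"
    and "dual_coeffs m \<mu> h"
    and "(\<lambda>l. ((norm l)\<^sup>2 + 1) ^ m * (norm (c l))\<^sup>2) summable_on Lattice"
    and "has_L2_sum (\<lambda>l x. c l * gabor l x) Lattice g"
    and "AE x in lborel. (\<Sum>j\<le>m. b j * gabor_comb m \<mu> (h j) x) + g x = 0"
  shows "(\<forall>j\<le>m. b j = 0) \<and> (\<forall>l\<in>Lattice. c l = 0)"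
proof -
  let ?M = "\<mu> ` {..m}"
  \<comment> \<open>The total coefficient of \<open>gabor (\<mu> s)\<close> once the dual functions
    are expanded.\<close>
  define a where "a s = (\<Sum>j\<le>m. b j * h j s)" for s
  \<comment> \<open>One coefficient function for all points: \<open>c\<close> on the lattice and
    \<open>a s\<close> at \<open>\<mu> s\<close>. Injectivity of \<mu> leaves a single term of the
    inner sum.\<close>
  define C where "C l = (if l \<in> Lattice then c l else \<Sum>s\<le>m. if \<mu> s = l then a s else 0)" for l
  have CL: "C l = c l" if "l \<in> Lattice" for l using that by (simp add: C_def)
  have notL: "\<mu> s \<notin> Lattice" if "s \<le> m" for s
    using assms(1) that Lattice_sharp_disjoint by auto
  have CM: "C (\<mu> s) = a s" if s: "s \<le> m" for s
  proof -
    have "C (\<mu> s) = (\<Sum>t\<le>m. if \<mu> t = \<mu> s then a t else 0)"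
      using notL[OF s] by (simp add: C_def)
    also have "\<dots> = (\<Sum>t\<le>m. if t = s then a t else 0)"
      using s by (intro sum.cong refl) (simp add: inj_on_eq_iff[OF assms(2)])
    finally have "C (\<mu> s) = (\<Sum>t\<le>m. if t = s then a t else 0)" .
    thus ?thesis using s by simp
  qed
  have sumM: "(\<Sum>l\<in>?M. C l * F l) = (\<Sum>s\<le>m. a s * F (\<mu> s))" for F
    by (subst sum.reindex[OF assms(2)]) (simp add: CM)
  have disj: "Lattice \<inter> ?M = {}" using notL by auto
  have sub: "Lattice \<union> ?M \<subseteq> Lattice \<union> sharp_Lattice" using assms(1) by auto

  have comb: "(\<Sum>j\<le>m. b j * gabor_comb m \<mu> (h j) x) = (\<Sum>s\<le>m. a s * gabor (\<mu> s) x)" for x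
    unfolding gabor_comb_def a_def sum_distrib_left sum_distrib_right
    by (subst sum.swap) (simp add: mult_ac)
  \<comment> \<open>Pairing with \<open>gabor v\<close> turns the sum in L2 and the identity almost
    everywhere into a numerical relation between overlaps.\<close>
  have rel: "((\<lambda>l. C l * overlap l v) has_sum 0) (Lattice \<union> ?M)" for v
  proof -
    let ?\<psi> = "\<lambda>x. cnj (gabor v x)"
    have ov: "(LINT x|lborel. k * gabor l x * ?\<psi> x) = k * overlap l v" for k l
      by (simp only: mult.assoc integral_mult_right_zero integral_gabor_cnj_gabor)
    have int: "integrable lborel (\<lambda>x. k * gabor l x * ?\<psi> x)" for k l
      by (intro L2_fun_mult_integrable L2_fun_cmult gabor_L2 L2_fun_cnj)
    have "((\<lambda>l. LINT x|lborel. c l * gabor l x * ?\<psi> x) has_sum (LINT x|lborel. g x * ?\<psi> x)) Lattice"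
      by (rule has_L2_sum_pairing[OF assms(5) L2_fun_cnj[OF gabor_L2]])
    moreover have "(LINT x|lborel. g x * ?\<psi> x) = - (\<Sum>l\<in>?M. C l * overlap l v)"
    proof -
      have [measurable]: "g \<in> borel_measurable lborel" "gabor l \<in> borel_measurable lborel"
        "?\<psi> \<in> borel_measurable lborel" for l
        using assms(5) gabor_L2 L2_fun_cnj[OF gabor_L2] by (auto simp: has_L2_sum_def L2_fun_def)
      have "(LINT x|lborel. g x * ?\<psi> x) = (LINT x|lborel. - (\<Sum>s\<le>m. a s * gabor (\<mu> s) x * ?\<psi> x))"
      proof (rule integral_cong_AE)
        show "AE x in lborel. g x * ?\<psi> x = - (\<Sum>s\<le>m. a s * gabor (\<mu> s) x * ?\<psi> x)"
          using assms(6)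
        proof eventually_elim
          case (elim x)
          hence "g x = - (\<Sum>s\<le>m. a s * gabor (\<mu> s) x)"
            unfolding comb by (simp add: eq_neg_iff_add_eq_0 add.commute)
          thus ?case by (simp add: sum_distrib_right)
        qed
      qed measurable
      also have "\<dots> = - (\<Sum>s\<le>m. a s * overlap (\<mu> s) v)"
        by (simp add: Bochner_Integration.integral_sum[OF int] ov)
      finally show ?thesis unfolding sumM .
    qed
    ultimately have 1: "((\<lambda>l. C l * overlap l v) has_sum - (\<Sum>l\<in>?M. C l * overlap l v)) Lattice"
      unfolding ov by (subst has_sum_cong[where g = "\<lambda>l. c l * overlap l v"]) (auto simp: CL)
    have 2: "((\<lambda>l. C l * overlap l v) has_sum (\<Sum>l\<in>?M. C l * overlap l v)) ?M"
      by (rule has_sum_finite) auto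
    show ?thesis using has_sum_Un_disjoint[OF 1 2 disj] by simp
  qed

  \<comment> \<open>Here the weight (|l|^2 + 1)^m enters: after multiplication by z^k with k \<le> m
    the coefficients are still square summable.\<close>
  have weighted: "(\<lambda>l. (norm (C l * to_complex l ^ k))\<^sup>2) summable_on Lattice" if "k \<le> m" for k
  proof (rule summable_on_comparison_test[OF assms(4)])
    fix l assume "l \<in> Lattice"
    have "(norm (C l * to_complex l ^ k))\<^sup>2 = ((norm l)\<^sup>2) ^ k * (norm (c l))\<^sup>2"
      using \<open>l \<in> Lattice\<close> by (simp add: CL norm_mult norm_power norm_to_complex power_mult_distrib power_mult[symmetric] mult.commute)
    also have "((norm l)\<^sup>2) ^ k \<le> ((norm l)\<^sup>2 + 1) ^ k" by (intro power_mono) auto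
    also have "\<dots> \<le> ((norm l)\<^sup>2 + 1) ^ m" using that by (intro power_increasing) auto
    finally show "(norm (C l * to_complex l ^ k))\<^sup>2 \<le> ((norm l)\<^sup>2 + 1) ^ m * (norm (c l))\<^sup>2"
      by (simp add: mult_right_mono)
  qed auto
  have l2: "(\<lambda>l. (norm (C l))\<^sup>2) summable_on Lattice" using weighted[of 0] by simp
  obtain K where K: "\<And>l. l \<in> Lattice \<union> ?M \<Longrightarrow> norm (C l) \<le> K"
    using l2_Un_finite_bounded[OF l2, of ?M] by blast
  have mv: "moments_vanish (Lattice \<union> ?M) C"
    using moments_vanish_iff_overlap[where c = C, OF sub K] rel by blast

  \<comment> \<open>The sharp functional is applied to the relation multiplied by z^k, that is,
    acted on by the k-th power of the annihilation operator. By duality the sharp points contribute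
    exactly \<open>b k\<close>.\<close>
  have bk: "b k = 0" if k: "k \<le> m" for k
  proof -
    have "(\<Sum>l\<in>?M. C l * to_complex l ^ k * sharp_sign l) = 0"
      using assms(1) weighted[OF k] moments_vanish_mult_to_complex[OF mv]
      by (intro moments_vanish_imp_sum_sharp_sign) auto
    hence "(\<Sum>s\<le>m. a s * (to_complex (\<mu> s) ^ k * sharp_sign (\<mu> s))) = 0"
      unfolding mult.assoc sumM .
    moreover have "(\<Sum>s\<le>m. a s * (to_complex (\<mu> s) ^ k * sharp_sign (\<mu> s)))
        = (\<Sum>j\<le>m. b j * (\<Sum>s\<le>m. h j s * to_complex (\<mu> s) ^ k * sharp_sign (\<mu> s)))"
      unfolding a_def sum_distrib_left sum_distrib_right
      by (subst sum.swap) (simp add: mult_ac)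
    moreover have "(\<Sum>s\<le>m. h j s * to_complex (\<mu> s) ^ k * sharp_sign (\<mu> s)) = (if k = j then 1 else 0)" if "j \<le> m" for j
      using assms(3) k that sharp_Poisson_gabor_comb[OF assms(1) Theta_0_nonzero[OF assms(3)]]
      by (simp add: dual_coeffs_def annihilation_funpow_gabor_comb)
    ultimately have "0 = (\<Sum>j\<le>m. b j * (if k = j then 1 else 0))" by simp
    also have "\<dots> = b k" using k by (simp add: if_distrib[of "\<lambda>x. _ * x"] cong: if_cong)
    finally show ?thesis by simp
  qed

  have "moments_vanish Lattice C"
    unfolding moments_vanish_def
  proof
    fix n
    \<comment> \<open>All coefficients at sharp points are now 0, so the relation lives on the
      lattice alone.\<close>
    have a0: "a s = 0" for s using bk by (simp add: a_def)
    have "((\<lambda>l. C l * fock_factor l * to_complex l ^ n) has_sum 0) (Lattice \<union> ?M)"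
      using mv by (simp add: moments_vanish_def)
    thus "((\<lambda>l. C l * fock_factor l * to_complex l ^ n) has_sum 0) Lattice"
      by (rule has_sum_cong_neutral[THEN iffD1, rotated -1]) (auto simp: CM a0)
  qed
  hence "c l = 0" if "l \<in> Lattice" for l
    using moments_vanish_imp_zero[OF l2 _ that] CL[OF that] by simp
  thus ?thesis using bk by simp
qed

end
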